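(* Let $1\le r\le n$. The Hilbert series of the Chow ring of the uniform matroid $U_{n,r}$ is \[ H\big(A(U_{n,r}),t\big)=\sum_{\sigma\in\mathfrak{S}_n}t^{\operatorname{exc}(\sigma)}-\sum_{j=r}^{n-1}\sum_{\sigma\in F_{n,n-j}}t^{\,j-\operatorname{exc}(\sigma)}, \] where $F_{n,m}=\{\sigma\in\mathfrak{S}_n:\#\operatorname{fix}(\sigma)\ge m\}$. In particular, $H(A(U_{n,n}),t)$ is the $n$-th Eulerian polynomial $\sum_{\sigma\in\mathfrak{S}_n}t^{\operatorname{exc}(\sigma)}$, and for $n\ge2$, $H\big(A(U_{n,n-1}),t\big)=\sum_{\sigma\in\mathcal{D}_n}t^{\operatorname{exc}(\sigma)-1}$.
   Context: The uniform matroid $U_{n,r}$ on ground set $[n]$ has as independent sets all subsets of size at most $r$; its lattice of flats consists of all subsets of $[n]$ of size at most $r-1$ together with $[n]$, ordered by inclusion. Chow ring: for a finite ranked lattice $L$ with minimum $\bot$, $A(L)=\mathbb{Z}[x_F : F\in L\setminus\{\bot\}]/I$ with $I$ generated by $x_Fx_G$ for incomparable $F,G$ and by $\sum_{F\ge a}x_F$ for each atom $a$; $A(U_{n,r})$ is the Chow ring of the lattice of flats, with Hilbert series $\sum_d\operatorname{rank}_{\mathbb{Z}}A_d\,t^d$. $\operatorname{exc}(\sigma)=\#\{i:\sigma(i)>i\}$; $\mathcal{D}_n$ is the set of derangements of $[n]$. *)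

theory Defs
  imports Main "HOL-Library.Poly_Mapping" "HOL-Computational_Algebra.Formal_Power_Series"
    "HOL-Combinatorics.Permutations"
begin

(* Integer polynomials in variables x_F indexed by sets F (flats).
   A monomial is a finitely supported exponent vector; a polynomial is a
   finitely supported map from monomials to integer coefficients. *)
type_synonym mono = "nat set \<Rightarrow>\<^sub>0 nat"
type_synonym ipoly = "mono \<Rightarrow>\<^sub>0 int"

definition pvar :: "nat set \<Rightarrow> ipoly" where
  "pvar F = Poly_Mapping.single (Poly_Mapping.single F 1) 1"

definition mono_deg :: "mono \<Rightarrow> nat" where
  "mono_deg m = (\<Sum>F\<in>Poly_Mapping.keys m. Poly_Mapping.lookup m F)"

definition poly_in :: "nat set set \<Rightarrow> ipoly \<Rightarrow> bool" where
  "poly_in V p \<longleftrightarrow> (\<forall>m\<in>Poly_Mapping.keys p. Poly_Mapping.keys m \<subseteq> V)"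

definition homog :: "nat \<Rightarrow> ipoly \<Rightarrow> bool" where
  "homog d p \<longleftrightarrow> (\<forall>m\<in>Poly_Mapping.keys p. mono_deg m = d)"

(* A finite lattice given as a family L of sets ordered by inclusion,
   with minimum b0. Atoms = elements covering b0. *)
definition lat_atoms :: "nat set set \<Rightarrow> nat set \<Rightarrow> nat set set" where
  "lat_atoms L b0 = {a\<in>L. b0 \<subset> a \<and> \<not>(\<exists>G\<in>L. b0 \<subset> G \<and> G \<subset> a)}"

definition chow_gens :: "nat set set \<Rightarrow> nat set \<Rightarrow> ipoly set" where
  "chow_gens L b0 =
     {pvar F * pvar G | F G. F \<in> L - {b0} \<and> G \<in> L - {b0} \<and> \<not> F \<subseteq> G \<and> \<not> G \<subseteq> F}
   \<union> {(\<Sum>F\<in>{F\<in>L - {b0}. a \<subseteq> F}. pvar F) | a. a \<in> lat_atoms L b0}"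

inductive_set chow_ideal :: "nat set set \<Rightarrow> nat set \<Rightarrow> ipoly set"
  for L :: "nat set set" and b0 :: "nat set" where
  zero: "0 \<in> chow_ideal L b0"
| step: "\<lbrakk>g \<in> chow_gens L b0; poly_in (L - {b0}) c; p \<in> chow_ideal L b0\<rbrakk>
          \<Longrightarrow> c * g + p \<in> chow_ideal L b0"

(* rank over Z of the degree-d part A_d of A(L) = Z[x]/I: the maximal number of
   elements of A_d (represented by homogeneous degree-d polynomials) that are
   Z-linearly independent modulo I *)
definition chow_rank :: "nat set set \<Rightarrow> nat set \<Rightarrow> nat \<Rightarrow> nat" where
  "chow_rank L b0 d = Sup {card S | S. finite S \<and>
      (\<forall>p\<in>S. poly_in (L - {b0}) p \<and> homog d p) \<and>
      (\<forall>c :: ipoly \<Rightarrow> int. (\<Sum>p\<in>S. of_int (c p) * p) \<in> chow_ideal L b0 \<longrightarrow> (\<forall>p\<in>S. c p = 0))}"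

definition chow_hilbert :: "nat set set \<Rightarrow> nat set \<Rightarrow> int fps" where
  "chow_hilbert L b0 = Abs_fps (\<lambda>d. int (chow_rank L b0 d))"

definition uniform_flats :: "nat \<Rightarrow> nat \<Rightarrow> nat set set" where
  "uniform_flats n r = {S. S \<subseteq> {1..n} \<and> card S \<le> r - 1} \<union> {{1..n}}"

definition exc :: "nat \<Rightarrow> (nat \<Rightarrow> nat) \<Rightarrow> nat" where
  "exc n \<sigma> = card {i\<in>{1..n}. \<sigma> i > i}"

definition nfix :: "nat \<Rightarrow> (nat \<Rightarrow> nat) \<Rightarrow> nat" where
  "nfix n \<sigma> = card {i\<in>{1..n}. \<sigma> i = i}"

definition F_set :: "nat \<Rightarrow> nat \<Rightarrow> (nat \<Rightarrow> nat) set" where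
  "F_set n m = {\<sigma>. \<sigma> permutes {1..n} \<and> nfix n \<sigma> \<ge> m}"

definition derangements :: "nat \<Rightarrow> (nat \<Rightarrow> nat) set" where
  "derangements n = {\<sigma>. \<sigma> permutes {1..n} \<and> (\<forall>i\<in>{1..n}. \<sigma> i \<noteq> i)}"

end

(*
  The ideal contains x_H (sum of all x_K with K >= G)^e whenever G is not below H and e is at least
  min(|G - H|, r - |H|); rewriting x_G^e by means of these relations strictly increases the weight
  sum m_F |F|, so the Feichtner-Yuzvinsky monomials span.  For r = n they are independent by counting:
  products of powers of the n linear forms with these monomials span the Stanley-Reisner ring of the
  order complex, and in each degree there are exactly as many of them as there are monomials supported
  on chains (Worpitzky's identity).  For r < n, multiplication by the (n - r)-th power of the top
  variable reduces independence to the case r = n.  Finally, the monomials in which the top set T occurs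
  and the derangements of T, counted by excedances, satisfy the same recursion in T.
*)

theory Submission
  imports Defs
begin

text \<open>Spanning is direct computation; the obstacle is independence, because straightening does
  not show that different reductions agree. The count that settles it: on [n] with r = n,
  Worpitzky's identity gives the Feichtner-Yuzvinsky monomials the generating function (1-X)^(n+1)
  times the series with coefficients (d+1)^n. Dividing by (1-X)^n, for the powers of n linear forms,
  leaves (d+1)^n - d^n in degree d. Chain monomials of degree d are as numerous because they encode
  functions from [n] to {0..d} attaining d, through level sets. A spanning family no larger than an
  independent family is itself independent. Homogeneous elements of the Chow ideal are combinations
  of products with at least one linear form, so a relation among Feichtner-Yuzvinsky monomials in
  the Chow ring extends to a relation among the products, and its coefficients vanish. All this
  happens over the integers, so elimination scales by pivots instead of dividing. The exponent n - r
  is just large enough to kill a flat of size r, and it equals the slack between the exponent bounds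
  at [n] in ranks r and n.\<close>

section \<open>Integral linear dependence\<close>

text \<open>Fraction-free Gaussian elimination: clearing coordinate \<open>i\<close> with a pivot
  \<open>p\<close> uses up one vector and one coordinate.\<close>

lemma int_vectors_dependent:
  fixes v :: "'a \<Rightarrow> 'b \<Rightarrow> int"
  assumes "finite I" "finite S" "card I < card S"
  shows "\<exists>c. (\<exists>s\<in>S. c s \<noteq> 0) \<and> (\<forall>i\<in>I. (\<Sum>s\<in>S. c s * v s i) = 0)"
  using assms
proof (induction I arbitrary: S v rule: finite_induct)
  case empty
  then have "S \<noteq> {}" by auto
  then show ?case by (intro exI[of _ "\<lambda>_. 1"]) auto
next
  case (insert i I)
  show ?case
  proof (cases "\<forall>s\<in>S. v s i = 0")
    case True
    from insert.IH[of S v] insert.prems insert.hyps obtain c where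
      "\<exists>s\<in>S. c s \<noteq> 0" "\<forall>i\<in>I. (\<Sum>s\<in>S. c s * v s i) = 0" by auto
    with True show ?thesis by (intro exI[of _ c]) auto
  next
    case False
    then obtain p where p: "p \<in> S" "v p i \<noteq> 0" by blast
    define w where "w s j = v p i * v s j - v s i * v p j" for s j
    have "card I < card (S - {p})"
      using insert.prems insert.hyps p by simp
    with insert.IH[of "S - {p}" w] insert.prems obtain c where
      c: "\<exists>s\<in>S-{p}. c s \<noteq> 0" "\<And>j. j \<in> I \<Longrightarrow>
          (\<Sum>s\<in>S-{p}. c s * w s j) = 0" by auto
    \<comment> \<open>The pivot's coefficient is chosen so that \<open>eq\<close> holds in every
      coordinate; in coordinate \<open>i\<close> it yields 0 because
      \<open>w s i = 0\<close>.\<close>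
    define c' where "c' s = (if s = p then - (\<Sum>s\<in>S-{p}. c s * v s i) else v p i * c s)" for s
    have eq: "(\<Sum>s\<in>S. c' s * v s j) = (\<Sum>s\<in>S-{p}. c s * w s j)" for j
    proof -
      have "(\<Sum>s\<in>S. c' s * v s j) = c' p * v p j + (\<Sum>s\<in>S-{p}. c' s * v s j)"
        using insert.prems p by (simp add: sum.remove)
      also have "(\<Sum>s\<in>S-{p}. c' s * v s j) = (\<Sum>s\<in>S-{p}. v p i * c s * v s j)"
        by (rule sum.cong) (auto simp: c'_def)
      finally have "(\<Sum>s\<in>S. c' s * v s j)
          = - (\<Sum>s\<in>S-{p}. c s * v s i) * v p j + (\<Sum>s\<in>S-{p}. v p i * c s * v s j)"
        by (simp add: c'_def[of p])
      then show ?thesis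
        by (simp only: w_def right_diff_distrib sum_subtractf sum_distrib_right) (simp add: algebra_simps sum_distrib_left)
    qed
    have "(\<Sum>s\<in>S. c' s * v s j) = 0" if "j \<in> insert i I" for j
      using that c(2) by (auto simp: eq) (simp add: w_def algebra_simps)
    moreover have "\<exists>s\<in>S. c' s \<noteq> 0" using c(1) p by (auto simp: c'_def)
    ultimately show ?thesis by blast
  qed
qed

text \<open>Integral combinations of the \<open>g i\<close> modulo \<open>K\<close>, kept free of
  explicit coefficients so that closure properties go by rule induction;
  \<open>int_span_imp_sum\<close> extracts coefficients for finite \<open>I\<close>.
  \<open>K\<close> will be the Chow ideal or the set of non-chain polynomials.\<close>

inductive int_span :: "('i \<Rightarrow> 'r::comm_ring_1) \<Rightarrow> 'i set \<Rightarrow> 'r set \<Rightarrow> 'r \<Rightarrow> bool"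
  for g I K where
  base: "p \<in> K \<Longrightarrow> int_span g I K p"
| step: "i \<in> I \<Longrightarrow> int_span g I K p \<Longrightarrow> int_span g I K (of_int c * g i + p)"

definition add_subgroup :: "'r::comm_ring_1 set \<Rightarrow> bool" where
  "add_subgroup K \<longleftrightarrow> 0 \<in> K \<and> (\<forall>p\<in>K. \<forall>q\<in>K. p + q
      \<in> K) \<and> (\<forall>c. \<forall>p\<in>K. of_int c * p \<in> K)"

lemma add_subgroup_sum:
  assumes "add_subgroup K" "\<And>i. i \<in> I \<Longrightarrow> f i \<in> K"
  shows "sum f I \<in> K"
  using assms(2) by (induction I rule: infinite_finite_induct) (use assms(1) in \<open>auto simp: add_subgroup_def\<close>)

lemma add_subgroup_diff:
  assumes "add_subgroup K" "p \<in> K" "q \<in> K"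
  shows "p - q \<in> K"
proof -
  have "of_int (-1) * q \<in> K" using assms unfolding add_subgroup_def by blast
  then have "p + of_int (-1) * q \<in> K" using assms unfolding add_subgroup_def by blast
  then show ?thesis by simp
qed

lemma int_span_add:
  assumes "add_subgroup K" "int_span g I K p" "int_span g I K q"
  shows "int_span g I K (p + q)"
  using assms(2,3)
proof (induction)
  case (base p)
  from base(2,1) show ?case
  proof (induction)
    case (base q) then show ?case using assms(1) by (auto simp: add_subgroup_def intro: int_span.base)
  next
    case (step i q c)
    then have "int_span g I K (of_int c * g i + (p + q))" by (intro int_span.step)
    then show ?case by (simp add: algebra_simps)
  qed
next
  case (step i p c)
  then have "int_span g I K (of_int c * g i + (p + q))" by (intro int_span.step)
  then show ?case by (simp add: algebra_simps)
qed

lemma int_span_scale: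
  assumes "add_subgroup K" "int_span g I K p"
  shows "int_span g I K (of_int a * p)"
  using assms(2)
proof (induction)
  case (base p) then show ?case using assms(1) by (auto simp: add_subgroup_def intro: int_span.base)
next
  case (step i p c)
  then have "int_span g I K (of_int (a * c) * g i + of_int a * p)" by (intro int_span.step)
  then show ?case by (simp add: algebra_simps)
qed

lemma int_span_sum:
  assumes "add_subgroup K" "\<And>i. i \<in> A \<Longrightarrow> int_span g I K (f i)"
  shows "int_span g I K (sum f A)"
  using assms(2)
  by (induction A rule: infinite_finite_induct)
    (use assms(1) in \<open>auto intro: int_span_add int_span.base simp: add_subgroup_def\<close>)

lemma int_span_generator:
  assumes "add_subgroup K" "i \<in> I"
  shows "int_span g I K (g i)"
proof -
  have "int_span g I K (of_int 1 * g i + 0)"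
    using assms by (intro int_span.intros) (auto simp: add_subgroup_def)
  then show ?thesis by simp
qed

lemma int_span_mono: "int_span g A K p \<Longrightarrow> A \<subseteq> B \<Longrightarrow> int_span g B K p"
  by (induction rule: int_span.induct) (auto intro: int_span.intros)

lemma int_span_imp_sum:
  assumes "finite I" "int_span g I K p"
  shows "\<exists>c. p - (\<Sum>i\<in>I. of_int (c i) * g i) \<in> K"
  using assms(2)
proof (induction)
  case (base p) then show ?case by (intro exI[of _ "\<lambda>_. 0"]) simp
next
  case (step i p a)
  then obtain c where c: "p - (\<Sum>i\<in>I. of_int (c i) * g i) \<in> K" by blast
  have "(\<Sum>j\<in>I. of_int ((c(i := c i + a)) j) * g j)
      = (\<Sum>j\<in>I. of_int (c j) * g j + (if j = i then of_int a * g i else 0))"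
    by (rule sum.cong) (auto simp: algebra_simps)
  also have "\<dots> = (\<Sum>j\<in>I. of_int (c j) * g j) + of_int a * g i"
    using assms(1) step(1) by (simp add: sum.distrib)
  finally have "(of_int a * g i + p) - (\<Sum>j\<in>I. of_int ((c(i := c i + a)) j) * g j) \<in> K"
    using c by (simp add: algebra_simps)
  then show ?case by blast
qed

text \<open>Coefficients over \<open>I\<close> are chosen for each \<open>v s\<close>; these are
  more integer vectors than coordinates, and a relation among them cancels every
  \<open>g i\<close>.\<close>

lemma spanned_imp_dependent:
  assumes K: "add_subgroup K" and fin: "finite I" "finite S" and card: "card I < card S"
    and span: "\<And>s. s \<in> S \<Longrightarrow> \<exists>a. v s - (\<Sum>i\<in>I. of_int (a i) * g i) \<in> K"
  shows "\<exists>c. (\<exists>s\<in>S. c s \<noteq> 0) \<and> (\<Sum>s\<in>S. of_int (c s) * v s) \<in> K"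
proof -
  from span obtain a where a: "\<And>s. s \<in> S \<Longrightarrow> v s - (\<Sum>i\<in>I. of_int (a s i) * g i) \<in> K" by metis
  from int_vectors_dependent[OF fin card, of a] obtain c where
    c: "\<exists>s\<in>S. c s \<noteq> 0" "\<And>i. i \<in> I \<Longrightarrow> (\<Sum>s\<in>S. c s * a s i) = 0" by blast
  have "(\<Sum>s\<in>S. of_int (c s) * (v s - (\<Sum>i\<in>I. of_int (a s i) * g i))) \<in> K"
    using a K by (intro add_subgroup_sum) (auto simp: add_subgroup_def)
  also have "(\<Sum>s\<in>S. of_int (c s) * (v s - (\<Sum>i\<in>I. of_int (a s i) * g i)))
      = (\<Sum>s\<in>S. of_int (c s) * v s) - (\<Sum>s\<in>S. \<Sum>i\<in>I. of_int (c s * a s i) * g i)"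
    by (simp add: right_diff_distrib sum_subtractf sum_distrib_left mult.assoc)
  also have "(\<Sum>s\<in>S. \<Sum>i\<in>I. of_int (c s * a s i) * g i)
      = (\<Sum>i\<in>I. of_int (\<Sum>s\<in>S. c s * a s i) * g i)"
    by (subst sum.swap) (simp add: sum_distrib_right)
  also have "\<dots> = 0" using c(2) by simp
  finally show ?thesis using c(1) by auto
qed

text \<open>If \<open>c i0\<close> were nonzero, \<open>g i0\<close> could be eliminated after
  scaling by \<open>c i0\<close>, and the scaled independent family would be spanned by fewer
  elements than it has.\<close>

lemma independent_of_count:
  assumes K: "add_subgroup K" and fin: "finite I" "finite M" and card: "card I \<le> card M"
    and span: "\<And>m. m \<in> M \<Longrightarrow> \<exists>a. v m - (\<Sum>i\<in>I. of_int (a i) * g i) \<in> K"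
    and indep: "\<And>e. (\<Sum>m\<in>M. of_int (e m) * v m) \<in> K \<Longrightarrow> \<forall>m\<in>M. e m = 0"
    and rel: "(\<Sum>i\<in>I. of_int (c i) * g i) \<in> K" and i0: "i0 \<in> I"
  shows "c i0 = (0::int)"
proof (rule ccontr)
  assume c0: "c i0 \<noteq> 0"
  have "\<exists>e. (\<exists>m\<in>M. e m \<noteq> 0) \<and> (\<Sum>m\<in>M. of_int (e m) * (of_int (c i0) * v m)) \<in> K"
  proof (rule spanned_imp_dependent[OF K, of "I - {i0}" M _ g])
    show "card (I - {i0}) < card M" using card i0 fin
      by (metis card_Diff1_less order_less_le_trans)
  next
    fix m assume "m \<in> M"
    then obtain a where a: "v m - (\<Sum>i\<in>I. of_int (a i) * g i) \<in> K" using span by blast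
    \<comment> \<open>Adding \<open>a i0\<close> times the relation cancels \<open>g i0\<close>:
      \<open>b i0 = 0\<close>.\<close>
    define b where "b i = c i0 * a i - a i0 * c i" for i
    have "of_int (c i0) * (v m - (\<Sum>i\<in>I. of_int (a i) * g i)) +
      of_int (a i0) * (\<Sum>i\<in>I. of_int (c i) * g i) \<in> K"
      using K a rel by (auto simp: add_subgroup_def)
    also have "of_int (c i0) * (v m - (\<Sum>i\<in>I. of_int (a i) * g i)) +
      of_int (a i0) * (\<Sum>i\<in>I. of_int (c i) * g i) = of_int (c i0) * v m - (\<Sum>i\<in>I. of_int (b i) * g i)"
      by (simp add: b_def sum_subtractf algebra_simps sum_distrib_left)
    also have "(\<Sum>i\<in>I. of_int (b i) * g i) = (\<Sum>i\<in>I-{i0}. of_int (b i) * g i)"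
      using fin i0 by (simp add: sum.remove b_def)
    finally show "\<exists>a. of_int (c i0) * v m - (\<Sum>i\<in>I - {i0}. of_int (a i) * g i) \<in> K" by blast
  qed (use fin in auto)
  then obtain e where e: "\<exists>m\<in>M. e m \<noteq> 0"
      "(\<Sum>m\<in>M. of_int (e m) * (of_int (c i0) * v m)) \<in> K" by blast
  have "\<forall>m\<in>M. e m * c i0 = 0" using e(2) by (intro indep) (simp add: mult.assoc)
  with e(1) c0 show False by auto
qed

section \<open>Graded polynomials and the Chow ideal\<close>

abbreviation monom_poly :: "mono \<Rightarrow> ipoly" where
  "monom_poly m \<equiv> Poly_Mapping.single m 1"

text \<open>Used with three weights: 1 for the degree, \<open>card\<close> for the straightening
  weight, and the indicator of a point to recover a height vector.\<close>

definition msum :: "(nat set \<Rightarrow> nat) \<Rightarrow> mono \<Rightarrow> nat" where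
  "msum f m = (\<Sum>F\<in>Poly_Mapping.keys m. Poly_Mapping.lookup m F * f F)"

lemma mono_deg_msum: "mono_deg m = msum (\<lambda>_. 1) m"
  by (simp add: mono_deg_def msum_def)

lemma msum_superset:
  assumes "finite A" "Poly_Mapping.keys m \<subseteq> A"
  shows "msum f m = (\<Sum>F\<in>A. Poly_Mapping.lookup m F * f F)"
  unfolding msum_def using assms
  by (intro sum.mono_neutral_left) (auto simp: in_keys_iff)

lemma keys_add_mono: "Poly_Mapping.keys (m + m') = Poly_Mapping.keys m \<union> Poly_Mapping.keys (m' :: mono)"
  by (auto simp: in_keys_iff lookup_add)

lemma keys_diff_mono: "Poly_Mapping.keys (m - m') \<subseteq> Poly_Mapping.keys (m :: mono)"
  by (auto simp: in_keys_iff lookup_minus)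

lemma msum_add: "msum f (m + m') = msum f m + msum f m'"
proof -
  let ?A = "Poly_Mapping.keys m \<union> Poly_Mapping.keys m'"
  show ?thesis
    by (simp add: msum_superset[of ?A m] msum_superset[of ?A m'] msum_superset[of ?A "m + m'"]
        keys_add_mono lookup_add distrib_right sum.distrib)
qed

lemma msum_zero [simp]: "msum f 0 = 0"
  by (simp add: msum_def)

lemma msum_single: "msum f (Poly_Mapping.single F k) = k * f F"
  by (simp add: msum_def)

lemma msum_sum: "msum f (sum g A) = (\<Sum>a\<in>A. msum f (g a))"
  by (induction A rule: infinite_finite_induct) (auto simp: msum_add)

lemma mono_deg_add: "mono_deg (m + m') = mono_deg m + mono_deg m'"
  by (simp add: mono_deg_msum msum_add)

lemma mono_deg_single: "mono_deg (Poly_Mapping.single F k) = k"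
  by (simp add: mono_deg_msum msum_single)

lemma mono_deg_zero [simp]: "mono_deg 0 = 0"
  by (simp add: mono_deg_msum)

lemma poly_eq_sum_monoms:
  "(p :: ipoly) = (\<Sum>m\<in>Poly_Mapping.keys p. of_int (Poly_Mapping.lookup p m) * monom_poly m)"
proof (rule poly_mapping_eqI)
  fix m
  have "Poly_Mapping.lookup (\<Sum>m\<in>Poly_Mapping.keys p. of_int (Poly_Mapping.lookup p m) * monom_poly m) m
     = (\<Sum>m'\<in>Poly_Mapping.keys p. if m' = m then Poly_Mapping.lookup p m else 0)"
    by (auto simp: lookup_sum mult_single lookup_single when_def simp flip: single_of_int intro!: sum.cong)
  also have "\<dots> = Poly_Mapping.lookup p m" by (auto simp: in_keys_iff)
  finally show "Poly_Mapping.lookup p m = Poly_Mapping.lookup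
     (\<Sum>m\<in>Poly_Mapping.keys p. of_int (Poly_Mapping.lookup p m) * monom_poly m) m" by simp
qed

lemma keys_multE:
  assumes "m \<in> Poly_Mapping.keys (p * q :: ipoly)"
  obtains a b where "a \<in> Poly_Mapping.keys p" "b \<in> Poly_Mapping.keys q" "m = a + b"
  using assms keys_mult[of p q] by blast

text \<open>\<open>w\<close> is only a lower bound for the weight, so the condition is closed under
  sums and can record the gain in straightening.\<close>

definition graded :: "nat set set \<Rightarrow> nat \<Rightarrow> nat \<Rightarrow> ipoly \<Rightarrow> bool" where
  "graded V d w p \<longleftrightarrow> (\<forall>m\<in>Poly_Mapping.keys p. Poly_Mapping.keys m \<subseteq> V \<and> mono_deg m = d \<and> w \<le> msum card m)"

lemma graded_iff: "graded V d 0 p \<longleftrightarrow> poly_in V p \<and> homog d p"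
  by (auto simp: graded_def poly_in_def homog_def)

lemma graded_weaken: "graded V d w p \<Longrightarrow> w' \<le> w \<Longrightarrow> graded V d w' p"
  by (fastforce simp: graded_def)

lemma graded_zero [simp]: "graded V d w 0"
  by (simp add: graded_def)

lemma graded_add: "graded V d w p \<Longrightarrow> graded V d w q \<Longrightarrow> graded V d w (p + q)"
  using keys_add[of p q] by (auto simp: graded_def)

lemma graded_uminus: "graded V d w p \<Longrightarrow> graded V d w (- p)"
  by (simp add: graded_def)

lemma graded_diff: "graded V d w p \<Longrightarrow> graded V d w q \<Longrightarrow> graded V d w (p - q)"
  using graded_add[of V d w p "- q"] by (simp add: graded_uminus)

lemma graded_sum: "(\<And>i. i \<in> A \<Longrightarrow> graded V d w (f i)) \<Longrightarrow> graded V d w (sum f A)"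
  by (induction A rule: infinite_finite_induct) (auto simp: graded_add)

lemma graded_mult: "graded V d w p \<Longrightarrow> graded V d' w' q \<Longrightarrow> graded V (d + d') (w + w') (p * q)"
  unfolding graded_def
proof (intro ballI)
  fix m assume *: "\<forall>m\<in>Poly_Mapping.keys p. Poly_Mapping.keys m \<subseteq> V \<and> mono_deg m
      = d \<and> w \<le> msum card m"
    "\<forall>m\<in>Poly_Mapping.keys q. Poly_Mapping.keys m \<subseteq> V \<and> mono_deg m = d' \<and> w' \<le> msum card m"
    and "m \<in> Poly_Mapping.keys (p * q)"
  from this(3) obtain a b where "a \<in> Poly_Mapping.keys p" "b \<in> Poly_Mapping.keys q" "m = a + b"
    by (rule keys_multE)
  with * show "Poly_Mapping.keys m \<subseteq> V \<and> mono_deg m = d + d' \<and> w + w' \<le> msum card m"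
    by (simp add: keys_add_mono mono_deg_add msum_add add_mono)
qed

lemma graded_monom: "Poly_Mapping.keys m \<subseteq> V \<Longrightarrow> graded V (mono_deg m) (msum card m) (monom_poly m)"
  by (simp add: graded_def)

lemma graded_of_int_0: "graded V 0 0 (of_int c)"
  unfolding graded_def single_of_int[symmetric] by simp

lemma graded_of_int: "graded V d w p \<Longrightarrow> graded V d w (of_int c * p)"
  using graded_mult[OF graded_of_int_0, of V d w p c] by simp

lemma graded_pvar: "F \<in> V \<Longrightarrow> w \<le> card F \<Longrightarrow> graded V 1 w (pvar F)"
  by (auto simp: graded_def pvar_def mono_deg_single msum_single)

lemma graded_power: "graded V 1 w p \<Longrightarrow> graded V k (k * w) (p ^ k)"
proof (induction k)
  case 0
  then show ?case by (simp add: graded_def)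
next
  case (Suc k)
  from graded_mult[OF Suc.prems Suc.IH[OF Suc.prems]] show ?case by simp
qed

lemma poly_in_mult: "poly_in V p \<Longrightarrow> poly_in V q \<Longrightarrow> poly_in V (p * q)"
  unfolding poly_in_def
proof (intro ballI)
  fix m assume *: "\<forall>m\<in>Poly_Mapping.keys p. Poly_Mapping.keys m \<subseteq> V"
    "\<forall>m\<in>Poly_Mapping.keys q. Poly_Mapping.keys m \<subseteq> V" and "m \<in> Poly_Mapping.keys (p * q)"
  from this(3) obtain a b where "a \<in> Poly_Mapping.keys p" "b \<in> Poly_Mapping.keys q" "m = a + b"
    by (rule keys_multE)
  with * show "Poly_Mapping.keys m \<subseteq> V" by (simp add: keys_add_mono)
qed

lemma poly_in_add: "poly_in V p \<Longrightarrow> poly_in V q \<Longrightarrow> poly_in V (p + q)"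
  using keys_add[of p q] by (auto simp: poly_in_def)

lemma poly_in_zero [simp]: "poly_in V 0"
  by (simp add: poly_in_def)

lemma poly_in_one [simp]: "poly_in V 1"
  by (simp add: poly_in_def)

lemma poly_in_of_int [simp]: "poly_in V (of_int c)"
  unfolding poly_in_def single_of_int[symmetric] by simp

lemma poly_in_power: "poly_in V p \<Longrightarrow> poly_in V (p ^ k)"
  by (induction k) (auto intro: poly_in_mult)

lemma poly_in_sum: "(\<And>i. i \<in> A \<Longrightarrow> poly_in V (f i)) \<Longrightarrow> poly_in V (sum f A)"
  by (induction A rule: infinite_finite_induct) (auto simp: poly_in_add)

lemma poly_in_pvar: "F \<in> V \<Longrightarrow> poly_in V (pvar F)"
  by (simp add: poly_in_def pvar_def)

lemma pvar_power: "pvar F ^ k = monom_poly (Poly_Mapping.single F k)"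
proof (induction k)
  case (Suc k)
  have "pvar F ^ Suc k = monom_poly (Poly_Mapping.single F 1 + Poly_Mapping.single F k)"
    using Suc by (simp add: pvar_def mult_single)
  then show ?case unfolding single_add[symmetric] by simp
qed simp

section \<open>Closure properties of the Chow ideal and its generators\<close>

lemma chow_ideal_add:
  assumes "p \<in> chow_ideal L b" "q \<in> chow_ideal L b"
  shows "p + q \<in> chow_ideal L b"
  using assms by (induction p rule: chow_ideal.induct) (auto simp: add.assoc intro: chow_ideal.step)

lemma chow_ideal_mult:
  assumes "p \<in> chow_ideal L b" "poly_in (L - {b}) c"
  shows "c * p \<in> chow_ideal L b"
  using assms
proof (induction p rule: chow_ideal.induct)
  case (step g a p)
  then have "(c * a) * g + c * p \<in> chow_ideal L b"
    by (intro chow_ideal.step poly_in_mult) auto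
  then show ?case by (simp add: algebra_simps)
qed (simp add: chow_ideal.zero)

lemma chow_ideal_generator: "g \<in> chow_gens L b \<Longrightarrow> g \<in> chow_ideal L b"
  using chow_ideal.step[of g L b 1 0] by (simp add: chow_ideal.zero)

lemma add_subgroup_chow_ideal: "add_subgroup (chow_ideal L b)"
  by (auto simp: add_subgroup_def chow_ideal.zero intro: chow_ideal_add chow_ideal_mult)

lemmas chow_ideal_diff = add_subgroup_diff[OF add_subgroup_chow_ideal]
lemmas chow_ideal_sum = add_subgroup_sum[OF add_subgroup_chow_ideal]

text \<open>For singletons \<open>G\<close> these are the linear generators of the Chow ideal; for
  larger \<open>G\<close> their powers give the straightening relations.\<close>

definition up_sum :: "nat set set \<Rightarrow> nat set \<Rightarrow> ipoly" where
  "up_sum L G = (\<Sum>H\<in>{H\<in>L - {{}}. G \<subseteq> H}. pvar H)"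

text \<open>The minimum of the lattice has no variable; reading it as 1 lets
  \<open>nilpotent\<close> cover the case without a factor \<open>pvar H\<close>.\<close>

definition pvar0 :: "nat set \<Rightarrow> ipoly" where
  "pvar0 H = (if H = {} then 1 else pvar H)"

definition is_chain :: "nat set set \<Rightarrow> bool" where
  "is_chain A \<longleftrightarrow> (\<forall>F\<in>A. \<forall>G\<in>A. F \<subseteq> G \<or> G \<subseteq> F)"

text \<open>In \<open>fy_monoms\<close> the bound need not be restricted to consecutive elements of the chain, as the
  largest \<open>G\<close> below \<open>F\<close> gives the strongest condition; \<open>min (card F) r\<close> is the rank of the flat \<open>F\<close>.\<close>

definition fy_monoms :: "nat set \<Rightarrow> nat \<Rightarrow> mono set" where
  "fy_monoms S r = {m. (\<forall>F\<in>Poly_Mapping.keys m. F \<subseteq> S \<and> F \<noteq> {} \<and> (F \<noteq> S \<longrightarrow> card F < r))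
      \<and> is_chain (Poly_Mapping.keys m)
      \<and> (\<forall>F\<in>Poly_Mapping.keys m. \<forall>G\<in>insert {} (Poly_Mapping.keys m).
            G \<subset> F \<longrightarrow> Poly_Mapping.lookup m F + card G < min (card F) r)}"

lemma incomparable_in_chow_ideal:
  assumes "F \<in> L - {{}}" "G \<in> L - {{}}" "\<not> F \<subseteq> G" "\<not> G \<subseteq> F"
  shows "pvar F * pvar G \<in> chow_ideal L {}"
  using assms by (intro chow_ideal_generator) (auto simp: chow_gens_def)

lemma non_chain_monom_in_chow_ideal:
  assumes "Poly_Mapping.keys m \<subseteq> L - {{}}" "\<not> is_chain (Poly_Mapping.keys m)"
  shows "monom_poly m \<in> chow_ideal L {}"
proof -
  obtain F G where FG: "F \<in> Poly_Mapping.keys m" "G \<in> Poly_Mapping.keys m" "\<not> F \<subseteq> G"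
      "\<not> G \<subseteq> F"
    using assms(2) by (auto simp: is_chain_def)
  have "F \<noteq> G" "0 < Poly_Mapping.lookup m F" "0 < Poly_Mapping.lookup m G"
    using FG by (auto simp: in_keys_iff)
  let ?fg = "Poly_Mapping.single F 1 + Poly_Mapping.single G (1::nat)"
  have "m = (m - ?fg) + ?fg"
    by (rule poly_mapping_eqI)
      (use \<open>F \<noteq> G\<close> \<open>0 < Poly_Mapping.lookup m F\<close> \<open>0 < Poly_Mapping.lookup m G\<close> in
        \<open>auto simp: lookup_add lookup_minus lookup_single when_def\<close>)
  then have "monom_poly m = monom_poly (m - ?fg) * (pvar F * pvar G)"
    by (metis mult_single pvar_def mult_1)
  moreover have "poly_in (L - {{}}) (monom_poly (m - ?fg))"
    using assms(1) keys_diff_mono[of m ?fg] by (auto simp: poly_in_def simp del: One_nat_def)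
  ultimately show ?thesis
    using incomparable_in_chow_ideal[of F L G] FG assms(1) by (auto intro: chow_ideal_mult)
qed

section \<open>Straightening\<close>

locale uniform_rank =
  fixes n r :: nat
  assumes r_pos: "1 \<le> r" and r_le: "r \<le> n"
begin

abbreviation "L \<equiv> uniform_flats n r"
abbreviation "V \<equiv> uniform_flats n r - {{}}"
abbreviation "J \<equiv> chow_ideal (uniform_flats n r) {}"

lemma flat_subset: "F \<in> L \<Longrightarrow> F \<subseteq> {1..n}"
  by (auto simp: uniform_flats_def)

lemma finite_flat: "F \<in> L \<Longrightarrow> finite F"
  using flat_subset finite_subset by blast

lemma finite_L: "finite L"
  by (rule finite_subset[of _ "Pow {1..n}"]) (auto simp: uniform_flats_def)

lemma top_flat: "{1..n} \<in> V"
  using r_pos r_le by (auto simp: uniform_flats_def)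

lemma atoms: "lat_atoms L {} = (if r = 1 then {{1..n}} else (\<lambda>a. {a}) ` {1..n})"
proof (cases "r = 1")
  case True
  then have "L = {{}, {1..n}}" by (auto simp: uniform_flats_def finite_subset)
  moreover have "lat_atoms {{}, E} {} = {E}" if "E \<noteq> {}" for E
    using that by (auto simp: lat_atoms_def)
  ultimately show ?thesis using True top_flat by simp
next
  case False
  then have sing: "{a} \<in> L" if "a \<in> {1..n}" for a
    using that r_pos by (auto simp: uniform_flats_def)
  have "a \<in> (\<lambda>a. {a}) ` {1..n}" if "a \<in> lat_atoms L {}" for a
  proof -
    from that obtain x where x: "x \<in> a" "a \<in> L" by (auto simp: lat_atoms_def)
    then have "{x} \<in> L" using sing flat_subset by blast
    with that x have "a = {x}" by (auto simp: lat_atoms_def)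
    with x flat_subset show ?thesis by blast
  qed
  moreover have "{a} \<in> lat_atoms L {}" if "a \<in> {1..n}" for a
    using sing[OF that] by (auto simp: lat_atoms_def)
  ultimately show ?thesis using False by auto
qed

text \<open>For \<open>r = 1\<close> the only atom is [n], but [n] is then the only nonempty flat
  and every singleton gives the same sum; one description thus serves all ranks.\<close>

lemma linear_generators:
  "{(\<Sum>F\<in>{F\<in>V. a \<subseteq> F}. pvar F) | a. a \<in> lat_atoms L {}} = (\<lambda>a. up_sum L {a}) ` {1..n}"
proof -
  have generators: "{(\<Sum>F\<in>{F\<in>V. a \<subseteq> F}. pvar F) | a. a \<in> lat_atoms L {}} = up_sum L ` lat_atoms L {}"
    unfolding up_sum_def by (rule Setcompr_eq_image)
  show ?thesis
  proof (cases "r = 1")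
    case True
    then have L: "L = {{}, {1..n}}" by (auto simp: uniform_flats_def finite_subset)
    have eq: "{H \<in> {{}, E} - {{}}. {a} \<subseteq> H} = {F \<in> {{}, E} - {{}}. E \<subseteq> F}" if "a
        \<in> E" for a and E :: "nat set"
      using that by auto
    have "up_sum L {a} = up_sum L {1..n}" if "a \<in> {1..n}" for a
      unfolding up_sum_def L by (simp only: eq[OF that])
    then have "(\<lambda>a. up_sum L {a}) ` {1..n} = (\<lambda>_. up_sum L {1..n}) ` {1..n}" by (rule image_cong[OF refl])
    also have "\<dots> = {up_sum L {1..n}}" using r_pos r_le by (intro image_constant[of 1]) simp
    finally have "(\<lambda>a. up_sum L {a}) ` {1..n} = {up_sum L {1..n}}" .
    moreover have "lat_atoms L {} = {{1..n}}" using True atoms by simp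
    ultimately show ?thesis unfolding generators by (simp only:) simp
  next
    case False
    then show ?thesis unfolding generators by (simp add: atoms image_image)
  qed
qed

lemma chow_gens_cases:
  assumes "g \<in> chow_gens L {}"
  obtains F G where "F \<in> V" "G \<in> V" "\<not> F \<subseteq> G" "\<not> G \<subseteq> F" "g = pvar F * pvar G"
    | a where "a \<in> {1..n}" "g = up_sum L {a}"
  using assms unfolding chow_gens_def linear_generators by blast

lemma linear_in_J: "a \<in> {1..n} \<Longrightarrow> up_sum L {a} \<in> J"
  by (intro chow_ideal_generator) (simp only: chow_gens_def linear_generators, blast)

lemma poly_in_up_sum: "poly_in V (up_sum L G)"
  unfolding up_sum_def by (intro poly_in_sum poly_in_pvar) auto

lemma poly_in_pvar0: "H \<in> L \<Longrightarrow> poly_in V (pvar0 H)"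
  by (auto simp: pvar0_def intro: poly_in_pvar)

text \<open>For a point \<open>a\<close> of \<open>G\<close> outside \<open>H\<close>, the linear
  generator at \<open>a\<close> replaces one factor \<open>up_sum L G\<close> by minus the sum over
  \<open>K\<close>. A flat \<open>k\<close> in \<open>K\<close> is either incomparable with
  \<open>H\<close>, or contains \<open>H\<close> strictly; then both terms of the minimum drop when
  \<open>H\<close> is replaced by \<open>k\<close>.\<close>

lemma nilpotent:
  assumes "H \<in> L" "G \<in> V" "\<not> G \<subseteq> H" "min (card (G - H)) (r - card H) \<le> e"
  shows "pvar0 H * up_sum L G ^ e \<in> J"
  using assms
proof (induction e arbitrary: H)
  case 0
  \<comment> \<open>Exponent 0 would force \<open>H\<close> to be [n], which contains
    \<open>G\<close>.\<close>
  have "finite G" using 0 finite_flat by auto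
  moreover have "G - H \<noteq> {}" using 0 by auto
  ultimately have "card (G - H) \<noteq> 0" by simp
  with 0 have "r - card H = 0" by (auto simp: min_def split: if_splits)
  then have "H = {1..n}" using 0(1) r_pos by (auto simp: uniform_flats_def)
  then show ?case using 0 flat_subset[of G] by auto
next
  case (Suc e)
  obtain a where a: "a \<in> G" "a \<notin> H" using Suc.prems by auto
  then have an: "a \<in> {1..n}" using Suc.prems flat_subset[of G] by auto
  define K where "K = {K\<in>V. {a} \<subseteq> K \<and> \<not> G \<subseteq> K}"
  have "{H \<in> V. {a} \<subseteq> H} = {H\<in>V. G \<subseteq> H} \<union> K" "{H\<in>V. G \<subseteq> H} \<inter> K = {}"
    using a by (auto simp: K_def)
  moreover have "finite K" "finite {H\<in>V. G \<subseteq> H}" using finite_L by (auto simp: K_def)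
  ultimately have split: "up_sum L {a} = up_sum L G + sum pvar K"
    unfolding up_sum_def by (simp add: sum.union_disjoint)
  have summand: "pvar0 H * pvar k * up_sum L G ^ e \<in> J" if k: "k \<in> K" for k
  proof -
    have kL: "k \<in> L" "k \<noteq> {}" "a \<in> k" "\<not> G \<subseteq> k" using k by (auto simp: K_def)
    show ?thesis
    proof (cases "H \<subseteq> k")
      case True
      have fin: "finite G" "finite k" "finite H" using Suc.prems kL finite_flat by auto
      have "card (G - k) < card (G - H)"
        using True a kL fin by (intro psubset_card_mono) auto
      moreover have "card H < card k"
        using True a kL fin by (intro psubset_card_mono) auto
      \<comment> \<open>\<open>k\<close> does not contain \<open>G\<close>, so it is not [n]; hence
        \<open>r - card k\<close> really decreases.\<close>
      moreover have "card k < r"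
        using kL flat_subset[of G] Suc.prems r_pos by (auto simp: uniform_flats_def)
      ultimately have "min (card (G - k)) (r - card k) \<le> e" using Suc.prems by linarith
      then have "pvar0 k * up_sum L G ^ e \<in> J" using Suc.IH kL Suc.prems by blast
      then have "pvar k * up_sum L G ^ e \<in> J" using kL by (simp add: pvar0_def)
      then show ?thesis
        using chow_ideal_mult[of "pvar k * up_sum L G ^ e" L "{}" "pvar0 H"] poly_in_pvar0[of H] Suc.prems
        by (simp add: mult.assoc)
    next
      case False
      then have "H \<noteq> {}" "\<not> k \<subseteq> H" using a kL by auto
      then have "pvar0 H * pvar k \<in> J"
        using incomparable_in_chow_ideal[of H L k] False kL Suc.prems by (auto simp: pvar0_def)
      then show ?thesis
        using chow_ideal_mult[of "pvar0 H * pvar k" L "{}" "up_sum L G ^ e"] poly_in_up_sum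
        by (simp add: mult.commute poly_in_power)
    qed
  qed
  have "(pvar0 H * up_sum L G ^ e) * up_sum L {a} - (\<Sum>k\<in>K. pvar0 H * pvar k * up_sum L G ^ e) \<in> J"
    using Suc.prems
    by (intro chow_ideal_diff chow_ideal_sum chow_ideal_mult linear_in_J an summand poly_in_mult
        poly_in_power poly_in_up_sum poly_in_pvar0) auto
  moreover have "(pvar0 H * up_sum L G ^ e) * up_sum L {a} - (\<Sum>k\<in>K. pvar0 H * pvar k * up_sum L G ^ e)
      = pvar0 H * up_sum L G ^ Suc e"
    unfolding split by (simp add: algebra_simps sum_distrib_left sum_distrib_right)
  ultimately show ?case by simp
qed

lemma graded_up_sum_diff:
  assumes "F \<in> V"
  shows "graded V 1 (Suc (card F)) (pvar F - up_sum L F)"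
proof -
  have "finite {H\<in>V. F \<subseteq> H}" using finite_L by auto
  then have "up_sum L F = pvar F + (\<Sum>H\<in>{H\<in>V. F \<subseteq> H} - {F}. pvar H)"
    unfolding up_sum_def using assms by (intro sum.remove) auto
  moreover have "graded V 1 (Suc (card F)) (\<Sum>H\<in>{H\<in>V. F \<subseteq> H} - {F}. pvar H)"
  proof (intro graded_sum graded_pvar)
    fix H assume H: "H \<in> {H\<in>V. F \<subseteq> H} - {F}"
    then have "card F < card H" using finite_flat by (intro psubset_card_mono) auto
    then show "Suc (card F) \<le> card H" by simp
  qed auto
  ultimately show ?thesis using graded_uminus by fastforce
qed

text \<open>All flats of \<open>up_sum L F\<close> other than \<open>F\<close> are strictly larger,
  and the difference cancels the one term of least weight.\<close>

lemma graded_power_diff: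
  assumes "F \<in> V"
  shows "graded V e (e * card F + 1) (pvar F ^ e - up_sum L F ^ e)"
proof (induction e)
  case (Suc e)
  have up: "graded V 1 (card F) (up_sum L F)"
    unfolding up_sum_def
  proof (intro graded_sum graded_pvar)
    fix H assume "H \<in> {H\<in>V. F \<subseteq> H}"
    then show "card F \<le> card H" using finite_flat by (intro card_mono) auto
  qed auto
  have 1: "graded V (e + 1) (e * card F + Suc (card F)) (pvar F ^ e * (pvar F - up_sum L F))"
    by (intro graded_mult graded_power graded_up_sum_diff graded_pvar assms order_refl)
  have 2: "graded V (e + 1) ((e * card F + 1) + card F) ((pvar F ^ e - up_sum L F ^ e) * up_sum L F)"
    by (intro graded_mult up Suc)
  have eq: "pvar F ^ Suc e - up_sum L F ^ Suc e
      = pvar F ^ e * (pvar F - up_sum L F) + (pvar F ^ e - up_sum L F ^ e) * up_sum L F"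
    by (simp add: algebra_simps)
  have "graded V (e + 1) (Suc e * card F + 1) (pvar F ^ e * (pvar F - up_sum L F))"
    "graded V (e + 1) (Suc e * card F + 1) ((pvar F ^ e - up_sum L F ^ e) * up_sum L F)"
    using 1 2 by (auto elim: graded_weaken)
  from graded_add[OF this] show ?case unfolding eq by simp
qed simp

lemma fy_monoms_keys: "m \<in> fy_monoms {1..n} r \<Longrightarrow> Poly_Mapping.keys m \<subseteq> V"
  using r_pos by (auto simp: fy_monoms_def uniform_flats_def)

text \<open>A violated bound for \<open>G\<close> below \<open>F\<close> is exactly the exponent
  condition of \<open>nilpotent\<close>; subtracting that element of the ideal leaves only terms of
  larger weight.\<close>

lemma straighten:
  assumes m: "Poly_Mapping.keys m \<subseteq> V" "m \<notin> fy_monoms {1..n} r"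
  shows "\<exists>p. graded V (mono_deg m) (Suc (msum card m)) p \<and> monom_poly m - p \<in> J"
proof (cases "is_chain (Poly_Mapping.keys m)")
  case False
  then show ?thesis
    using non_chain_monom_in_chow_ideal[OF m(1)] by (intro exI[of _ 0]) auto
next
  case True
  have *: "\<forall>F\<in>Poly_Mapping.keys m. F \<subseteq> {1..n} \<and> F \<noteq> {} \<and> (F \<noteq> {1..n} \<longrightarrow> card F < r)"
  proof
    fix F assume "F \<in> Poly_Mapping.keys m"
    then have "F \<in> V" using m(1) by blast
    then show "F \<subseteq> {1..n} \<and> F \<noteq> {} \<and> (F \<noteq> {1..n} \<longrightarrow> card F < r)"
      using r_pos by (auto simp: uniform_flats_def)
  qed
  have "\<not> (\<forall>F\<in>Poly_Mapping.keys m. \<forall>G\<in>insert {} (Poly_Mapping.keys m).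
      G \<subset> F \<longrightarrow> Poly_Mapping.lookup m F + card G < min (card F) r)" (is "\<not> ?fy")
  proof
    assume ?fy
    with True * have "m \<in> fy_monoms {1..n} r" unfolding fy_monoms_def by (intro CollectI conjI)
    with m(2) show False by contradiction
  qed
  then obtain F G where F: "F \<in> Poly_Mapping.keys m"
    and G: "G \<in> insert {} (Poly_Mapping.keys m)" and GF: "G \<subset> F"
    and big: "\<not> Poly_Mapping.lookup m F + card G < min (card F) r" by blast
  define e where "e = Poly_Mapping.lookup m F"
  \<comment> \<open>A single factor for \<open>G\<close> is enough for \<open>nilpotent\<close>; it
    is trivial when \<open>G\<close> is the minimum, matching \<open>pvar0\<close>.\<close>
  define g where "g = (if G = {} then 0 else Poly_Mapping.single G (1::nat))"
  define m0 where "m0 = m - (Poly_Mapping.single F e + g)"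
  have FV: "F \<in> V" using F m(1) by auto
  have GL: "G \<in> L" using G m(1) by (auto simp: uniform_flats_def)
  have "Poly_Mapping.lookup m G = Suc (Poly_Mapping.lookup m G - 1)" if "G \<noteq> {}"
    using G that by (auto simp: in_keys_iff)
  moreover have ne: "F \<noteq> G" "G \<noteq> F" using GF by auto
  ultimately have meq: "m = m0 + (Poly_Mapping.single F e + g)"
    unfolding m0_def using ne
    by (intro poly_mapping_eqI) (auto simp: lookup_add lookup_minus lookup_single when_def e_def g_def)
  have pg: "pvar0 G = monom_poly g" by (simp add: pvar0_def g_def pvar_def)
  have m_poly: "monom_poly m = monom_poly m0 * (pvar0 G * pvar F ^ e)"
    unfolding pg pvar_power by (subst meq) (simp add: mult_single ac_simps)
  define p where "p = monom_poly m0 * (pvar0 G * (pvar F ^ e - up_sum L F ^ e))"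
  have m0V: "Poly_Mapping.keys m0 \<subseteq> V" "Poly_Mapping.keys g \<subseteq> V"
    using keys_diff_mono m(1) G by (auto simp: m0_def g_def)
  have "graded V (mono_deg m0 + (mono_deg g + e)) (msum card m0 + (msum card g + (e * card F + 1))) p"
    unfolding p_def pg by (intro graded_mult graded_monom m0V graded_power_diff FV)
  moreover have "mono_deg m = mono_deg m0 + (mono_deg g + e)"
    by (subst meq) (simp add: mono_deg_add mono_deg_single)
  moreover have "msum card m = msum card m0 + (msum card g + e * card F)"
    by (subst meq) (simp add: msum_add msum_single)
  ultimately have "graded V (mono_deg m) (Suc (msum card m)) p" by simp
  moreover have "monom_poly m - p \<in> J"
  proof -
    have "finite F" "finite G" using FV GL finite_flat by auto
    then have "min (card (F - G)) (r - card G) \<le> e"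
      using big GF by (simp add: card_Diff_subset e_def) linarith
    then have "monom_poly m0 * (pvar0 G * up_sum L F ^ e) \<in> J"
      using GF m0V by (intro chow_ideal_mult nilpotent GL FV) (auto simp: poly_in_def)
    moreover have "monom_poly m - p = monom_poly m0 * (pvar0 G * up_sum L F ^ e)"
      by (simp add: m_poly p_def algebra_simps)
    ultimately show ?thesis by simp
  qed
  ultimately show ?thesis by blast
qed

definition basis :: "nat \<Rightarrow> mono set" where
  "basis d = {m \<in> fy_monoms {1..n} r. mono_deg m = d}"

text \<open>Bounds the weight in a fixed degree, so straightening terminates.\<close>

lemma weight_le: "Poly_Mapping.keys m \<subseteq> V \<Longrightarrow> msum card m \<le> mono_deg m * n"
  unfolding msum_def mono_deg_def sum_distrib_right
proof (rule sum_mono, rule mult_le_mono2)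
  fix F assume "Poly_Mapping.keys m \<subseteq> V" "F \<in> Poly_Mapping.keys m"
  then have "F \<subseteq> {1..n}" using flat_subset by auto
  then show "card F \<le> n" using card_mono[of "{1..n}" F] by simp
qed

text \<open>Induction on the room left below the maximal weight \<open>d * n\<close>: beyond it the
  polynomial is 0, and each monomial outside the basis is traded for terms of weight at least
  \<open>w + 1\<close>.\<close>

lemma spanning:
  assumes "graded V d w p"
  shows "int_span monom_poly (basis d) J p"
  using assms
proof (induction "Suc (d * n) - w" arbitrary: w p rule: less_induct)
  case less
  show ?case
  proof (cases "w \<le> d * n")
    case False
    have "m \<notin> Poly_Mapping.keys p" for m
    proof
      assume "m \<in> Poly_Mapping.keys p"
      with less.prems have "Poly_Mapping.keys m \<subseteq> V" "mono_deg m = d" "w \<le> msum card m"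
        unfolding graded_def by blast+
      with weight_le[of m] False show False by simp
    qed
    then have "Poly_Mapping.keys p = {}" by blast
    then have "p = 0" by simp
    then show ?thesis by (auto intro!: int_span.base chow_ideal.zero)
  next
    case True
    have "int_span monom_poly (basis d) J (monom_poly m)" if m: "m \<in> Poly_Mapping.keys p" for m
    proof (cases "m \<in> fy_monoms {1..n} r")
      case True
      with m less.prems have "m \<in> basis d" by (auto simp: basis_def graded_def)
      then show ?thesis by (rule int_span_generator[OF add_subgroup_chow_ideal])
    next
      case False
      have m': "Poly_Mapping.keys m \<subseteq> V" "mono_deg m = d" "w \<le> msum card m"
        using m less.prems by (auto simp: graded_def)
      from straighten[OF m'(1) False] obtain q where
        q: "graded V d (Suc (msum card m)) q" "monom_poly m - q \<in> J" using m' by auto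
      from q(1) have "graded V d (Suc w) q" by (rule graded_weaken) (use m' in simp)
      then have "int_span monom_poly (basis d) J q"
        by (intro less.hyps[of "Suc w"]) (use True in simp)
      from int_span_add[OF add_subgroup_chow_ideal this int_span.base[OF q(2)]] show ?thesis by simp
    qed
    then have "int_span monom_poly (basis d) J
        (\<Sum>m\<in>Poly_Mapping.keys p. of_int (Poly_Mapping.lookup p m) * monom_poly m)"
      by (rule int_span_sum[OF add_subgroup_chow_ideal int_span_scale[OF add_subgroup_chow_ideal]])
    then show ?thesis by (simp only: poly_eq_sum_monoms[of p, symmetric])
  qed
qed

end

section \<open>Counting Feichtner-Yuzvinsky monomials\<close>

text \<open>The empty set gets the monomial 1 (exponent vector 0), so that a pure power of the
  variable of \<open>S\<close> decomposes over \<open>T = {}\<close>.\<close>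

definition fy_top :: "nat set \<Rightarrow> mono set" where
  "fy_top S = (if S = {} then {0} else {m \<in> fy_monoms S (card S). S \<in> Poly_Mapping.keys m})"

definition top_poly :: "nat set \<Rightarrow> int fps" where
  "top_poly S = (\<Sum>m\<in>fy_top S. fps_X ^ mono_deg m)"

lemma Union_chain_mem:
  assumes "finite A" "A \<noteq> {}" "is_chain A"
  shows "\<Union>A \<in> A"
  using assms
proof (induction A rule: finite_ne_induct)
  case (insert F A)
  then have "\<Union>A \<in> A" by (auto simp: is_chain_def)
  with insert.prems have "F \<subseteq> \<Union>A \<or> \<Union>A \<subseteq> F" by (auto simp: is_chain_def)
  then have "\<Union>(insert F A) = \<Union>A \<or> \<Union>(insert F A) = F" by auto
  with \<open>\<Union>A \<in> A\<close> show ?case by (metis insertCI)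
qed simp

lemma fy_topD:
  assumes "m \<in> fy_top T" "F \<in> Poly_Mapping.keys m"
  shows "F \<subseteq> T" "F \<noteq> {}"
  using assms by (auto simp: fy_top_def fy_monoms_def split: if_splits)

lemma Union_keys_fy_top: "m \<in> fy_top T \<Longrightarrow> \<Union>(Poly_Mapping.keys m) = T"
  using fy_topD(1)[of m T] by (auto simp: fy_top_def split: if_splits)

lemma fy_top_chain: "m \<in> fy_top T \<Longrightarrow> is_chain (Poly_Mapping.keys m)"
  by (auto simp: fy_top_def fy_monoms_def is_chain_def split: if_splits)

lemma fy_top_bound:
  assumes "finite T" "m \<in> fy_top T" "F \<in> Poly_Mapping.keys m" "G \<in> insert {} (Poly_Mapping.keys m)" "G \<subset> F"
  shows "Poly_Mapping.lookup m F + card G < card F"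
proof -
  have "T \<noteq> {}" using assms(2,3) by (auto simp: fy_top_def)
  then have "m \<in> fy_monoms T (card T)" using assms(2) by (simp add: fy_top_def)
  then have "Poly_Mapping.lookup m F + card G < min (card F) (card T)"
    using assms(3-5) unfolding fy_monoms_def by blast
  then show ?thesis by simp
qed

text \<open>At \<open>S\<close> only the largest flat \<open>T\<close> of \<open>m\<close> matters,
  and the bound there is \<open>r\<close>; flats inside \<open>T\<close> have fewer than
  \<open>r\<close> elements, so truncating ranks at \<open>r\<close> does not affect them.\<close>

lemma add_top_in_fy_monoms:
  assumes S: "finite S" "r \<le> card S" and T: "T \<subset> S" "card T < r"
    and m: "m \<in> fy_top T" and e: "e < r - card T"
  shows "m + Poly_Mapping.single S e \<in> fy_monoms S r"
proof -
  have fin: "finite T" using T S finite_subset by blast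
  let ?m = "m + Poly_Mapping.single S e"
  have S_notin: "S \<notin> Poly_Mapping.keys m" using fy_topD(1)[OF m] T by blast
  have keys: "Poly_Mapping.keys ?m = Poly_Mapping.keys m \<union> (if e = 0 then {} else {S})"
    by (simp add: keys_add_mono)
  have small: "F \<subset> S \<and> F \<noteq> {} \<and> F \<subseteq> T \<and> card F \<le> card T" if "F
      \<in> Poly_Mapping.keys m" for F
    using fy_topD[OF m that] T card_mono[OF fin] by blast
  have "S \<noteq> {}" using T by auto
  have 1: "F \<subseteq> S \<and> F \<noteq> {} \<and> (F \<noteq> S \<longrightarrow> card F < r)" if "F
      \<in> Poly_Mapping.keys ?m" for F
  proof (cases "F \<in> Poly_Mapping.keys m")
    case True
    with small[OF this] T show ?thesis by (auto intro: order_le_less_trans)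
  next
    case False
    then have "F = S" using that keys by (auto split: if_splits)
    with \<open>S \<noteq> {}\<close> show ?thesis by simp
  qed
  have 2: "is_chain (Poly_Mapping.keys ?m)"
    using fy_top_chain[OF m] small unfolding keys is_chain_def by (auto split: if_splits)
  have 3: "Poly_Mapping.lookup ?m F + card G < min (card F) r"
    if F: "F \<in> Poly_Mapping.keys ?m" and G: "G \<in> insert {} (Poly_Mapping.keys ?m)" "G \<subset> F" for F G
  proof (cases "F \<in> Poly_Mapping.keys m")
    case True
    then have "G \<noteq> S" using G small by blast
    then have "G \<in> insert {} (Poly_Mapping.keys m)" using G keys by (auto split: if_splits)
    from fy_top_bound[OF fin m True this G(2)] have "Poly_Mapping.lookup m F + card G < card F" .
    moreover have "F \<noteq> S" "card F < r" using small[OF True] T by auto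
    ultimately show ?thesis by (simp add: lookup_add lookup_single when_def)
  next
    case False
    then have FS: "F = S" using F keys by (auto split: if_splits)
    then have "G \<in> insert {} (Poly_Mapping.keys m)" using G keys by (auto split: if_splits)
    then have "card G \<le> card T" using small by auto
    then show ?thesis
      using FS S_notin e S by (simp add: lookup_add in_keys_iff)
  qed
  show ?thesis unfolding fy_monoms_def using 1 2 3 by blast
qed

text \<open>\<open>T\<close> is the largest remaining flat, since a finite nonempty chain contains
  its union. Flats inside \<open>T\<close> have size below \<open>r\<close>, so what remains is a
  Boolean monomial on \<open>T\<close>.\<close>

lemma remove_top_of_fy_monoms:
  assumes S: "finite S" "S \<noteq> {}" "r \<le> card S" "1 \<le> r" and m: "m \<in> fy_monoms S r"
  defines "e \<equiv> Poly_Mapping.lookup m S"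
  defines "m' \<equiv> m - Poly_Mapping.single S e"
  defines "T \<equiv> \<Union>(Poly_Mapping.keys m')"
  shows "T \<subset> S" "card T < r" "m' \<in> fy_top T" "e < r - card T" "m = m' + Poly_Mapping.single S e"
proof -
  have lookup: "Poly_Mapping.lookup m' F = (if F = S then 0 else Poly_Mapping.lookup m F)" for F
    by (simp add: m'_def e_def lookup_minus lookup_single when_def)
  have keys: "Poly_Mapping.keys m' = Poly_Mapping.keys m - {S}"
    by (auto simp: in_keys_iff lookup split: if_splits)
  show "m = m' + Poly_Mapping.single S e"
    by (rule poly_mapping_eqI) (simp add: lookup_add lookup lookup_single when_def e_def)
  have m1: "F \<subseteq> S" "F \<noteq> {}" "F \<noteq> S \<Longrightarrow> card F < r" if "F \<in> Poly_Mapping.keys m" for F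
    using m that unfolding fy_monoms_def by blast+
  have m2: "is_chain (Poly_Mapping.keys m)" using m unfolding fy_monoms_def by blast
  have m3: "Poly_Mapping.lookup m F + card G < min (card F) r"
    if "F \<in> Poly_Mapping.keys m" "G \<in> insert {} (Poly_Mapping.keys m)" "G \<subset> F" for F G
    using m that unfolding fy_monoms_def by blast
  have T_cases: "T = {} \<and> m' = 0 \<or> T \<noteq> {} \<and> T \<in> Poly_Mapping.keys m'"
  proof (cases "m' = 0")
    case True
    then show ?thesis by (simp add: T_def)
  next
    case False
    have "is_chain (Poly_Mapping.keys m')" using m2 unfolding keys is_chain_def by blast
    with False have "T \<in> Poly_Mapping.keys m'" unfolding T_def by (intro Union_chain_mem) auto
    moreover from this have "T \<noteq> {}" using m1 keys by blast
    ultimately show ?thesis by blast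
  qed
  show TS: "T \<subset> S" using T_cases m1[of T] keys S by auto
  show Tr: "card T < r"
  proof (cases "T = {}")
    case False
    then have "T \<in> Poly_Mapping.keys m" using T_cases keys by blast
    from m1(3)[OF this] TS show ?thesis by blast
  qed (use S in simp)
  have T_in: "T \<in> insert {} (Poly_Mapping.keys m)" using T_cases keys by auto
  show "e < r - card T"
  proof (cases "e = 0")
    case False
    then have "S \<in> Poly_Mapping.keys m" by (simp add: e_def in_keys_iff)
    from m3[OF this T_in TS] show ?thesis unfolding e_def by linarith
  qed (use Tr in simp)
  show "m' \<in> fy_top T"
  proof (cases "T = {}")
    case True
    then show ?thesis using T_cases by (simp add: fy_top_def)
  next
    case False
    have fin: "finite T" using TS S finite_subset by blast
    have sub: "F \<subseteq> T" if "F \<in> Poly_Mapping.keys m'" for F using that unfolding T_def by blast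
    have "F \<subseteq> T \<and> F \<noteq> {} \<and> (F \<noteq> T \<longrightarrow> card F < card T)" if "F
        \<in> Poly_Mapping.keys m'" for F
      using sub[OF that] that m1[of F] keys psubset_card_mono[OF fin, of F] by blast
    moreover have "is_chain (Poly_Mapping.keys m')" using m2 unfolding keys is_chain_def by blast
    moreover have "Poly_Mapping.lookup m' F + card G < min (card F) (card T)"
      if F: "F \<in> Poly_Mapping.keys m'" and G: "G \<in> insert {} (Poly_Mapping.keys m')" "G \<subset> F" for F G
    proof -
      have "Poly_Mapping.lookup m F + card G < min (card F) r"
        using F G keys by (intro m3) auto
      moreover have "card F \<le> card T" using sub[OF F] fin by (rule card_mono[rotated])
      ultimately show ?thesis using F keys by (simp add: lookup)
    qed
    ultimately have "m' \<in> fy_monoms T (card T)" unfolding fy_monoms_def by blast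
    then show ?thesis using False T_cases by (simp add: fy_top_def)
  qed
qed

text \<open>Splits off the power of the variable of \<open>S\<close>, exponent 0 allowed; the rest
  is sorted by its largest flat, which reduces every rank to Boolean data.\<close>

lemma bij_betw_fy_monoms:
  assumes S: "finite S" "S \<noteq> {}" "r \<le> card S" "1 \<le> r"
  shows "bij_betw (\<lambda>(T, m, e). m + Poly_Mapping.single S e)
    (SIGMA T:{T. T \<subseteq> S \<and> card T < r}. fy_top T \<times> {..<r - card T}) (fy_monoms S r)"
    (is "bij_betw ?f ?A _")
proof -
  have TS: "T \<subset> S" if "T \<subseteq> S" "card T < r" for T using that S by auto
  define h where "h m = (let e = Poly_Mapping.lookup m S; m' = m - Poly_Mapping.single S e
    in (\<Union>(Poly_Mapping.keys m'), m', e))" for m :: mono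
  show ?thesis
  proof (rule bij_betw_byWitness[where f' = h])
    show "\<forall>x\<in>?A. h (?f x) = x"
    proof
      fix x assume "x \<in> ?A"
      then obtain T m e where x: "x = (T, m, e)"
        and *: "T \<subseteq> S" "card T < r" "m \<in> fy_top T" "e \<in> {..<r - card T}" by auto
      have "S \<notin> Poly_Mapping.keys m" using fy_topD(1)[OF *(3)] TS[OF *(1,2)] by blast
      then have "Poly_Mapping.lookup (m + Poly_Mapping.single S e) S = e"
        by (simp add: lookup_add in_keys_iff)
      then show "h (?f x) = x"
        using Union_keys_fy_top[OF *(3)] by (simp add: h_def Let_def x)
    qed
    show "\<forall>m\<in>fy_monoms S r. ?f (h m) = m"
    proof
      fix m assume "m \<in> fy_monoms S r"
      from remove_top_of_fy_monoms(5)[OF S this, symmetric] show "?f (h m) = m"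
        by (simp add: h_def Let_def)
    qed
    show "?f ` ?A \<subseteq> fy_monoms S r"
    proof (rule image_subsetI)
      fix x assume "x \<in> ?A"
      then obtain T m e where "x = (T, m, e)" "T \<subseteq> S" "card T < r" "m \<in> fy_top T" "e < r - card T"
        by auto
      then show "?f x \<in> fy_monoms S r"
        using add_top_in_fy_monoms[OF S(1,3) TS] by simp
    qed
    show "h ` fy_monoms S r \<subseteq> ?A"
    proof (rule image_subsetI)
      fix m assume "m \<in> fy_monoms S r"
      from remove_top_of_fy_monoms(1-4)[OF S this] show "h m \<in> ?A"
        by (simp add: h_def Let_def psubset_imp_subset)
    qed
  qed
qed

lemma finite_fy_top: "finite S \<Longrightarrow> finite (fy_top S)"
proof (induction S rule: finite_psubset_induct)
  case (psubset S)
  show ?case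
  proof (cases "S = {}")
    case False
    then have card: "1 \<le> card S" using psubset by (simp add: Suc_leI card_gt_0_iff)
    have "finite (SIGMA T:{T. T \<subseteq> S \<and> card T < card S}. fy_top T \<times> {..<card S - card T})"
      using psubset by (intro finite_SigmaI finite_cartesian_product) auto
    then have "finite (fy_monoms S (card S))"
      using bij_betw_finite[OF bij_betw_fy_monoms[OF psubset.hyps False order_refl card]] by simp
    then show ?thesis using False by (simp add: fy_top_def)
  qed (simp add: fy_top_def)
qed

lemma finite_fy_monoms:
  assumes "finite S" "S \<noteq> {}" "r \<le> card S" "1 \<le> r"
  shows "finite (fy_monoms S r)"
proof -
  have "finite (SIGMA T:{T. T \<subseteq> S \<and> card T < r}. fy_top T \<times> {..<r - card T})"
    using assms finite_fy_top finite_subset[of _ S] by (intro finite_SigmaI finite_cartesian_product) auto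
  then show ?thesis using bij_betw_finite[OF bij_betw_fy_monoms[OF assms]] by simp
qed

lemma sum_fy_monoms:
  fixes g :: "mono \<Rightarrow> 'a::comm_monoid_add"
  assumes S: "finite S" "S \<noteq> {}" "r \<le> card S" "1 \<le> r"
  shows "sum g (fy_monoms S r) = (\<Sum>T\<in>{T. T \<subseteq> S \<and> card T < r}. \<Sum>m\<in>fy_top T. \<Sum>e<r - card T.
    g (m + Poly_Mapping.single S e))"
proof -
  have fin: "finite {T. T \<subseteq> S \<and> card T < r}" using S by simp
  have "sum g (fy_monoms S r)
      = (\<Sum>(T, m, e)\<in>(SIGMA T:{T. T \<subseteq> S \<and> card T < r}. fy_top T \<times> {..<r - card T}).
    g (m + Poly_Mapping.single S e))"
    unfolding sum.reindex_bij_betw[OF bij_betw_fy_monoms[OF S], symmetric] by (rule sum.cong) auto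
  also have "\<dots> = (\<Sum>T\<in>{T. T \<subseteq> S \<and> card T < r}. \<Sum>(m, e)\<in>fy_top T \<times> {..<r - card T}.
    g (m + Poly_Mapping.single S e))"
    using S finite_fy_top finite_subset[of _ S] by (subst sum.Sigma[OF fin]) auto
  also have "\<dots> = (\<Sum>T\<in>{T. T \<subseteq> S \<and> card T < r}. \<Sum>m\<in>fy_top T. \<Sum>e<r - card T.
    g (m + Poly_Mapping.single S e))"
    by (simp add: sum.cartesian_product)
  finally show ?thesis .
qed

lemma fy_monoms_generating_function:
  assumes S: "finite S" "S \<noteq> {}" "r \<le> card S" "1 \<le> r"
  shows "(\<Sum>m\<in>fy_monoms S r. fps_X ^ mono_deg m) =
    (\<Sum>T\<in>{T. T \<subseteq> S \<and> card T < r}. top_poly T * (\<Sum>e<r - card T. fps_X ^ e))"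
  unfolding sum_fy_monoms[OF S] top_poly_def
  by (simp add: mono_deg_add mono_deg_single power_add sum_product)

text \<open>The decomposition at rank \<open>card S\<close> without \<open>e = 0\<close>, since the
  variable of \<open>S\<close> must occur.\<close>

lemma top_poly_recursion:
  assumes S: "finite S" "S \<noteq> {}"
  shows "top_poly S = (\<Sum>T\<in>{T. T \<subseteq> S \<and> card T < card S}. top_poly T * (\<Sum>e\<in>{1..<card S - card T}. fps_X ^ e))"
proof -
  have card: "1 \<le> card S" using S by (simp add: Suc_leI card_gt_0_iff)
  let ?g = "\<lambda>m. if Poly_Mapping.lookup m S \<noteq> 0 then fps_X ^ mono_deg m else (0 :: int fps)"
  have "top_poly S = sum ?g (fy_monoms S (card S))"
    unfolding top_poly_def using finite_fy_monoms[OF S order_refl card] S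
    by (simp add: fy_top_def in_keys_iff sum.inter_filter)
  also have "\<dots> = (\<Sum>T\<in>{T. T \<subseteq> S \<and> card T < card S}. \<Sum>m\<in>fy_top T. \<Sum>e<card S - card T.
    ?g (m + Poly_Mapping.single S e))"
    by (rule sum_fy_monoms[OF S order_refl card])
  also have "\<dots> = (\<Sum>T\<in>{T. T \<subseteq> S \<and> card T < card S}. \<Sum>m\<in>fy_top T. \<Sum>e\<in>{1..<card S - card T}.
    fps_X ^ mono_deg m * fps_X ^ e)"
  proof (rule sum.cong[OF refl], rule sum.cong[OF refl])
    fix T m assume "T \<in> {T. T \<subseteq> S \<and> card T < card S}" "m \<in> fy_top T"
    then have "S \<notin> Poly_Mapping.keys m" using fy_topD(1)[of m T S] by auto
    then have "?g (m + Poly_Mapping.single S e) = (if e = 0 then 0 else fps_X ^ mono_deg m * fps_X ^ e)" for e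
      by (simp add: lookup_add in_keys_iff mono_deg_add mono_deg_single power_add)
    then have "(\<Sum>e<card S - card T. ?g (m + Poly_Mapping.single S e))
      = (\<Sum>e<card S - card T. if e = 0 then 0 else fps_X ^ mono_deg m * fps_X ^ e)" by simp
    also have "\<dots> = (\<Sum>e\<in>{1..<card S - card T}. fps_X ^ mono_deg m * fps_X ^ e)"
      by (rule sum.mono_neutral_cong_right) auto
    finally show "(\<Sum>e<card S - card T. ?g (m + Poly_Mapping.single S e))
      = (\<Sum>e\<in>{1..<card S - card T}. fps_X ^ mono_deg m * fps_X ^ e)" .
  qed
  finally show ?thesis by (simp add: top_poly_def sum_product)
qed

lemma top_poly_empty: "top_poly {} = 1"
  by (simp add: top_poly_def fy_top_def)

section \<open>Recursions over subsets and Worpitzky's identity\<close>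

lemma sum_Pow_power_card:
  fixes x y :: "'a::comm_ring_1"
  assumes "finite A"
  shows "(\<Sum>B\<in>Pow A. x ^ card B * y ^ (card A - card B)) = (x + y) ^ card A"
proof -
  have "(x + y) ^ card A = (\<Sum>B\<in>Pow A. (\<Prod>_\<in>B. x) * (\<Prod>_\<in>A-B. y))"
    unfolding prod_add[OF assms, symmetric] by simp
  also have "\<dots> = (\<Sum>B\<in>Pow A. x ^ card B * y ^ (card A - card B))"
    by (rule sum.cong[OF refl]) (auto simp: card_Diff_subset finite_subset[OF _ assms])
  finally show ?thesis ..
qed

text \<open>The coefficient ring has no zero divisors, so the relation at \<open>S\<close> with
  nonzero diagonal coefficient determines the value at \<open>S\<close> from those at proper
  subsets.\<close>

lemma subset_recursion_unique:
  fixes f g :: "nat set \<Rightarrow> int fps"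
  assumes f: "\<And>S. finite S \<Longrightarrow> S \<noteq> {} \<Longrightarrow> (\<Sum>T\<in>Pow S. c S T * f T) = 0"
    and g: "\<And>S. finite S \<Longrightarrow> S \<noteq> {} \<Longrightarrow> (\<Sum>T\<in>Pow S. c S T * g T) = 0"
    and c: "\<And>S. c S S \<noteq> 0" and empty: "f {} = g {}"
  shows "finite S \<Longrightarrow> f S = g S"
proof (induction S rule: finite_psubset_induct)
  case (psubset S)
  show ?case
  proof (cases "S = {}")
    case False
    have "(\<Sum>T\<in>Pow S - {S}. c S T * f T) = (\<Sum>T\<in>Pow S - {S}. c S T * g T)"
      using psubset.IH by (intro sum.cong) auto
    then have "c S S * f S = c S S * g S"
      using f[OF psubset.hyps False] g[OF psubset.hyps False] psubset.hyps
      by (simp add: sum.remove[of "Pow S" S] eq_neg_iff_add_eq_0[symmetric])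
    then show ?thesis using c by simp
  qed (use empty in simp)
qed

lemma fps_X_minus_one_nonzero: "fps_X - 1 \<noteq> (0 :: int fps)" "1 - fps_X \<noteq> (0 :: int fps)"
proof -
  have "(fps_X :: int fps) \<noteq> 1"
  proof
    assume "(fps_X :: int fps) = 1"
    then have "fps_nth (fps_X :: int fps) 0 = fps_nth 1 0" by simp
    then show False by simp
  qed
  then show "fps_X - 1 \<noteq> (0 :: int fps)" "1 - fps_X \<noteq> (0 :: int fps)" by auto
qed

text \<open>For derangement polynomials in place of \<^const>\<open>top_poly\<close>, the relation says that the numbers of
  weak excedances and of excedances plus one are equidistributed over all permutations of \<open>S\<close>.\<close>

lemma top_poly_relation:
  assumes S: "finite S" "S \<noteq> {}"
  shows "(\<Sum>T\<in>Pow S. (fps_X - fps_X ^ (card S - card T)) * top_poly T) = 0"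
proof -
  \<comment> \<open>Multiplying the recursion by \<open>1 - fps_X\<close> collapses its geometric
    sums into the coefficients of the relation.\<close>
  have geo: "(1 - fps_X) * (\<Sum>e\<in>{1..<k}. fps_X ^ e) = (fps_X - fps_X ^ k :: int fps)" if "1 \<le> k" for k
    using that
  proof (induction k rule: dec_induct)
    case (step k)
    have "(1 - fps_X) * (\<Sum>e\<in>{1..<Suc k}. fps_X ^ e)
        = (1 - fps_X) * (\<Sum>e\<in>{1..<k}. fps_X ^ e) + (1 - fps_X) * (fps_X ^ k :: int fps)"
      using step.hyps by (simp add: distrib_left)
    then show ?case unfolding step.IH by (simp add: algebra_simps)
  qed simp
  have P: "Pow S = insert S {T. T \<subseteq> S \<and> card T < card S}"
    using card_subset_eq[OF S(1)] card_mono[OF S(1)] by (auto simp: order.strict_iff_order)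
  have fin: "finite {T. T \<subseteq> S \<and> card T < card S}" using S by simp
  have "(\<Sum>T\<in>Pow S. (fps_X - fps_X ^ (card S - card T)) * top_poly T) =
      (fps_X - 1) * top_poly S + (\<Sum>T\<in>{T. T \<subseteq> S \<and> card T < card S}. (fps_X - fps_X ^ (card S
          - card T)) * top_poly T)"
    unfolding P using fin by simp
  also have "(\<Sum>T\<in>{T. T \<subseteq> S \<and> card T < card S}. (fps_X - fps_X ^ (card S - card T)) * top_poly T)
      = (\<Sum>T\<in>{T. T \<subseteq> S \<and> card T < card S}. ((1 - fps_X) * (\<Sum>e\<in>{1..<card S
          - card T}. fps_X ^ e)) * top_poly T)"
    by (intro sum.cong refl arg_cong2[where f = times] geo[symmetric]) auto
  also have "\<dots> = (1 - fps_X) * top_poly S"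
    unfolding top_poly_recursion[OF S] by (simp add: sum_distrib_left ac_simps)
  finally show ?thesis by (simp add: algebra_simps)
qed

text \<open>For fixed \<open>U\<close>, the sets \<open>T\<close> between \<open>U\<close> and
  \<open>S\<close> contribute the binomial expansion of
  \<open>((fps_X - 1) + 1) ^ card (S - U)\<close>.\<close>

lemma sum_Pow_Pow:
  assumes S: "finite S"
  shows "(\<Sum>T\<in>Pow S. (fps_X - 1) ^ (card S - card T) * (\<Sum>U\<in>Pow T. f U))
    = (\<Sum>U\<in>Pow S. fps_X ^ (card S - card U) * (f U :: int fps))"
proof -
  have "(\<Sum>T\<in>Pow S. (fps_X - 1) ^ (card S - card T) * (\<Sum>U\<in>Pow T. f U))
     = (\<Sum>T\<in>Pow S. \<Sum>U\<in>{U\<in>Pow S. U \<subseteq> T}. (fps_X - 1) ^ (card S - card T) * f U)"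
    by (auto simp: sum_distrib_left intro!: sum.cong)
  also have "\<dots> = (\<Sum>U\<in>Pow S. \<Sum>T\<in>{T\<in>Pow S. U \<subseteq> T}. (fps_X - 1) ^ (card S - card T) * f U)"
    using S by (intro sum.swap_restrict) auto
  also have "\<dots> = (\<Sum>U\<in>Pow S. fps_X ^ (card S - card U) * f U)"
  proof (rule sum.cong[OF refl])
    fix U assume U: "U \<in> Pow S"
    then have fU: "finite U" "finite (S - U)" using S finite_subset by auto
    have bij: "bij_betw (\<lambda>B. S - B) (Pow (S - U)) {T\<in>Pow S. U \<subseteq> T}"
      by (rule bij_betw_byWitness[where f' = "\<lambda>T. S - T"]) (use U in auto)
    have "(\<Sum>T\<in>{T\<in>Pow S. U \<subseteq> T}. (fps_X - 1) ^ (card S - card T) * f U)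
      = (\<Sum>B\<in>Pow (S - U). (fps_X - 1) ^ (card S - card (S - B)) * f U)"
      by (rule sum.reindex_bij_betw[OF bij, symmetric])
    also have "\<dots> = (\<Sum>B\<in>Pow (S - U). (fps_X - 1) ^ card B * 1 ^ (card (S - U) - card B) * f U)"
    proof (rule sum.cong[OF refl])
      fix B assume "B \<in> Pow (S - U)"
      then have "B \<subseteq> S" "finite B" using S finite_subset by auto
      then have "card (S - B) = card S - card B" "card B \<le> card S"
        using S by (auto simp: card_Diff_subset intro: card_mono)
      then show "(fps_X - 1) ^ (card S - card (S - B)) * f U
        = (fps_X - 1) ^ card B * 1 ^ (card (S - U) - card B) * f U" by simp
    qed
    also have "\<dots> = fps_X ^ card (S - U) * f U"
      unfolding sum_distrib_right[symmetric] by (subst sum_Pow_power_card[OF fU(2)]) simp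
    also have "card (S - U) = card S - card U" using U fU by (simp add: card_Diff_subset)
    finally show "(\<Sum>T\<in>{T\<in>Pow S. U \<subseteq> T}. (fps_X - 1) ^ (card S - card T) * f U)
      = fps_X ^ (card S - card U) * f U" .
  qed
  finally show ?thesis .
qed

definition power_series :: "nat \<Rightarrow> int fps" where
  "power_series k = Abs_fps (\<lambda>d. (int d + 1) ^ k)"

text \<open>In degree \<open>d\<close> this is the binomial expansion of
  \<open>((d + 1) - 1) ^ card S\<close>; as \<open>S\<close> is nonempty, degree 0 agrees with the
  shift by \<open>fps_X\<close>.\<close>

lemma power_series_alternating:
  assumes S: "finite S" "S \<noteq> {}"
  shows "(\<Sum>T\<in>Pow S. (- 1) ^ (card S - card T) * power_series (card T)) = fps_X * power_series (card S)"
proof (rule fps_ext)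
  fix d
  have m1: "fps_nth ((- 1) ^ k * f :: int fps) d = (- 1) ^ k * fps_nth f d" for k f
    by (cases "even k") auto
  have "fps_nth (\<Sum>T\<in>Pow S. (- 1) ^ (card S - card T) * power_series (card T)) d
    = (\<Sum>T\<in>Pow S. (int d + 1) ^ card T * (- 1) ^ (card S - card T))"
    by (simp add: fps_sum_nth m1 power_series_def mult.commute)
  also have "\<dots> = int d ^ card S" using sum_Pow_power_card[OF S(1), of "int d + 1" "- 1"] by simp
  also have "\<dots> = fps_nth (fps_X * power_series (card S)) d"
    using S by (cases d) (auto simp: power_series_def card_gt_0_iff add.commute)
  finally show "fps_nth (\<Sum>T\<in>Pow S. (- 1) ^ (card S - card T) * power_series (card T)) d
    = fps_nth (fps_X * power_series (card S)) d" .
qed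

text \<open>For both sides \<open>h\<close>, summing
  \<open>(fps_X - 1) ^ (card S - card T) * h T\<close> over subsets \<open>T\<close> gives
  \<open>fps_X * h S\<close>: on the left by \<open>top_poly_relation\<close> after exchanging sums,
  on the right by \<open>power_series_alternating\<close>. The diagonal coefficient is
  \<open>1 - fps_X\<close>.\<close>

lemma sum_top_poly_worpitzky:
  assumes "finite S"
  shows "(\<Sum>T\<in>Pow S. top_poly T) = (1 - fps_X) ^ Suc (card S) * power_series (card S)"
proof (rule subset_recursion_unique[where c = "\<lambda>S T. (fps_X - 1) ^ (card S - card T) - (if T = S then fps_X else 0)"
      and f = "\<lambda>S. sum top_poly (Pow S)" and g = "\<lambda>S. (1
          - fps_X) ^ Suc (card S) * power_series (card S)", OF _ _ _ _ assms])
  have split: "(\<Sum>T\<in>Pow S. ((fps_X - 1) ^ (card S - card T) - (if T = S then fps_X else 0)) * h T)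
     = (\<Sum>T\<in>Pow S. (fps_X - 1) ^ (card S - card T) * h T) - fps_X * h S"
    if "finite S" for S :: "nat set" and h :: "nat set \<Rightarrow> int fps"
  proof -
    have "(\<Sum>T\<in>Pow S. (if T = S then fps_X else 0) * h T) = (\<Sum>T\<in>Pow S. if T = S then fps_X * h S else 0)"
      by (rule sum.cong) auto
    also have "\<dots> = fps_X * h S" using that by simp
    finally show ?thesis by (simp add: left_diff_distrib sum_subtractf)
  qed
  fix S :: "nat set" assume S: "finite S" "S \<noteq> {}"
  show "(\<Sum>T\<in>Pow S. ((fps_X - 1) ^ (card S - card T) - (if T = S then fps_X else 0)) * sum top_poly (Pow T)) = 0"
    unfolding split[OF S(1)] sum_Pow_Pow[OF S(1)]
    using top_poly_relation[OF S] by (simp add: left_diff_distrib sum_subtractf sum_distrib_left)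
  have "(\<Sum>T\<in>Pow S. (fps_X - 1) ^ (card S - card T) * ((1 - fps_X) ^ Suc (card T) * power_series (card T)))
     = (\<Sum>T\<in>Pow S. (1 - fps_X) ^ Suc (card S) * ((- 1) ^ (card S - card T) * power_series (card T)))"
  proof (rule sum.cong[OF refl])
    fix T assume "T \<in> Pow S"
    then have "card T \<le> card S" using S by (auto intro: card_mono)
    then have "Suc (card S) = (card S - card T) + Suc (card T)" by simp
    then have e: "(1 - fps_X :: int fps) ^ Suc (card S) = (1 - fps_X) ^ (card S - card T) * (1 - fps_X) ^ Suc (card T)"
      by (metis power_add)
    have "(fps_X - 1 :: int fps) = (- 1) * (1 - fps_X)" by simp
    then have "(fps_X - 1 :: int fps) ^ (card S - card T) = (- 1) ^ (card S - card T) * (1 - fps_X) ^ (card S - card T)"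
      by (metis power_mult_distrib)
    then show "(fps_X - 1) ^ (card S - card T) * ((1 - fps_X) ^ Suc (card T) * power_series (card T))
      = (1 - fps_X) ^ Suc (card S) * ((- 1) ^ (card S - card T) * power_series (card T))"
      unfolding e by (simp only: ac_simps)
  qed
  also have "\<dots> = (1 - fps_X) ^ Suc (card S) * (fps_X * power_series (card S))"
    by (simp only: sum_distrib_left[symmetric] power_series_alternating[OF S])
  finally show "(\<Sum>T\<in>Pow S. ((fps_X - 1) ^ (card S - card T) - (if T = S then fps_X else 0)) *
      ((1 - fps_X) ^ Suc (card T) * power_series (card T))) = 0"
    unfolding split[OF S(1)] by (simp add: ac_simps)
next
  show "(fps_X - 1) ^ (card S - card S) - (if S = S then fps_X else 0) \<noteq> (0 :: int fps)" for S :: "nat set"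
    using fps_X_minus_one_nonzero by simp
  have "(1 - fps_X) * power_series 0 = 1"
  proof (rule fps_ext)
    fix d show "fps_nth ((1 - fps_X) * power_series 0) d = fps_nth 1 d"
      by (cases d) (auto simp: left_diff_distrib power_series_def)
  qed
  then show "sum top_poly (Pow {}) = (1 - fps_X) ^ Suc (card {}) * power_series (card {})"
    by (simp add: top_poly_empty)
qed

section \<open>Excedances of derangements\<close>

text \<open>No ground set is mentioned: fixed points do not count, so one value serves for every set
  that is permuted.\<close>

definition exceed :: "(nat \<Rightarrow> nat) \<Rightarrow> nat" where
  "exceed \<sigma> = card {i. i < \<sigma> i}"

definition derange :: "nat set \<Rightarrow> (nat \<Rightarrow> nat) set" where
  "derange T = {\<sigma>. \<sigma> permutes T \<and> (\<forall>i\<in>T. \<sigma> i \<noteq> i)}"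

definition derange_poly :: "nat set \<Rightarrow> int fps" where
  "derange_poly T = (\<Sum>\<sigma>\<in>derange T. fps_X ^ exceed \<sigma>)"

lemma derange_support: "\<sigma> \<in> derange T \<Longrightarrow> {i. \<sigma> i \<noteq> i} = T"
  by (auto simp: derange_def) (metis permutes_not_in)

lemma finite_derange: "finite T \<Longrightarrow> finite (derange T)"
  by (rule finite_subset[OF _ finite_permutations[of T]]) (auto simp: derange_def)

text \<open>Each permutation is a derangement of its set of moved points, and of no other
  set.\<close>

lemma permutations_by_support:
  assumes "finite S"
  shows "sum f {\<sigma>. \<sigma> permutes S} = (\<Sum>T\<in>Pow S. sum f (derange T))"
proof -
  have "{\<sigma>. \<sigma> permutes S} = (\<Union>T\<in>Pow S. derange T)"
  proof (intro equalityI subsetI)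
    fix \<sigma> assume "\<sigma> \<in> {\<sigma>. \<sigma> permutes S}"
    then have \<sigma>: "\<sigma> permutes S" by simp
    have "\<sigma> permutes {i. \<sigma> i \<noteq> i}"
      using \<sigma> by (auto simp: permutes_def)
    then have "\<sigma> \<in> derange {i. \<sigma> i \<noteq> i}" by (simp add: derange_def)
    moreover have "{i. \<sigma> i \<noteq> i} \<subseteq> S" using \<sigma> by (auto simp: permutes_def)
    ultimately show "\<sigma> \<in> (\<Union>T\<in>Pow S. derange T)" by blast
  qed (auto simp: derange_def intro: permutes_subset)
  moreover have "derange T \<inter> derange U = {}" if "T \<noteq> U" for T U
    using that derange_support by blast
  ultimately show ?thesis
    using assms finite_derange finite_subset[of _ S] by (simp add: sum.UNION_disjoint)
qed

text \<open>Postcomposition with this cyclic shift turns weak excedances into excedances, losing exactly the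
  position whose value is the maximum.\<close>

lemma cyclic_successor_exists:
  fixes S :: "nat set"
  assumes "finite S" "S \<noteq> {}"
  shows "\<exists>c. c permutes S \<and> (\<forall>x\<in>S. \<forall>y\<in>S. x < c y \<longleftrightarrow> x \<le> y \<and> y \<noteq> Max S)"
  using assms
proof (induction S rule: finite_linorder_max_induct)
  case (insert b S)
  show ?case
  proof (cases "S = {}")
    case True
    then show ?thesis by (intro exI[of _ id]) (auto intro: permutes_id)
  next
    case False
    then obtain c where c: "c permutes S" "\<And>x y. x \<in> S \<Longrightarrow> y \<in> S \<Longrightarrow>
        x < c y \<longleftrightarrow> x \<le> y \<and> y \<noteq> Max S"
      using insert.IH by blast
    define M where "M = Max S"
    have M: "M \<in> S" "\<And>x. x \<in> S \<Longrightarrow> x \<le> M" using insert.hyps False by (auto simp: M_def)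
    have b: "b \<notin> S" "\<And>x. x \<in> S \<Longrightarrow> x < b" "Max (insert b S) = b"
      using insert.hyps False M by (auto simp: max_def M_def[symmetric] intro: antisym)
    have cS: "c y \<in> S" if "y \<in> S" for y using c(1) that by (simp add: permutes_in_image)
    have cb: "c b = b" using c(1) b(1) by (simp add: permutes_not_in)
    \<comment> \<open>Inserts the new maximum into the cycle: \<open>M\<close> goes to
      \<open>b\<close>, and \<open>b\<close> to the former image of \<open>M\<close>.\<close>
    define c' where "c' = c \<circ> transpose M b"
    have "c' permutes insert b S"
      unfolding c'_def using M c(1)
      by (intro permutes_compose permutes_swap_id permutes_subset[OF c(1)]) auto
    moreover have "x < c' y \<longleftrightarrow> x \<le> y \<and> y \<noteq> b" if x: "x \<in> insert b S"
        and y: "y \<in> insert b S" for x y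
    proof -
      consider "y = b" | "y = M" "y \<noteq> b" | "y \<in> S" "y \<noteq> M" "y \<noteq> b" using y by auto
      then show ?thesis
      proof cases
        case 1
        then have "c' y = c M" by (simp add: c'_def)
        then show ?thesis
          using x 1 c(2)[of x M] M b(2)[OF cS[OF M(1)]] by (cases "x = b") (auto simp: M_def[symmetric])
      next
        case 2
        then have "c' y = b" by (simp add: c'_def cb)
        then show ?thesis using x 2 M(2)[of x] b(2)[of x] b(2)[OF M(1)] by (cases "x = b") auto
      next
        case 3
        then have "c' y = c y" by (simp add: c'_def transpose_def)
        then show ?thesis
          using x 3 c(2)[of x y] b(2)[of y] b(2)[OF cS[of y]] by (cases "x = b") (auto simp: M_def[symmetric])
      qed
    qed
    ultimately show ?thesis using b(3) by auto
  qed
qed simp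

lemma sum_exceed_shift:
  assumes S: "finite S" "S \<noteq> {}"
  shows "fps_X * (\<Sum>\<sigma>\<in>{\<sigma>. \<sigma> permutes S}. fps_X ^ exceed \<sigma>)
    = (\<Sum>\<sigma>\<in>{\<sigma>. \<sigma> permutes S}. fps_X ^ card {i\<in>S. i \<le> \<sigma> i} :: int fps)"
proof -
  obtain c where c: "c permutes S" "\<And>x y. x \<in> S \<Longrightarrow> y \<in> S \<Longrightarrow>
      x < c y \<longleftrightarrow> x \<le> y \<and> y \<noteq> Max S"
    using cyclic_successor_exists[OF S] by blast
  have "Suc (exceed (c \<circ> \<sigma>)) = card {i\<in>S. i \<le> \<sigma> i}" if \<sigma>: "\<sigma> permutes S" for \<sigma>
  proof -
    \<comment> \<open>The position of the maximum is always a weak excedance and the only one lost,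
      whence the factor \<open>fps_X\<close>.\<close>
    define j where "j = inv \<sigma> (Max S)"
    have j: "\<sigma> j = Max S" "j \<in> S"
      using \<sigma> S by (auto simp: j_def permutes_inverses permutes_in_image[OF permutes_inv])
    have "{i. i < (c \<circ> \<sigma>) i} = {i\<in>S. i \<le> \<sigma> i} - {j}"
    proof (intro set_eqI)
      fix i
      have "\<sigma> i = Max S \<longleftrightarrow> i = j" using j \<sigma> by (metis permutes_inverses(2))
      moreover have "c (\<sigma> i) = i" if "i \<notin> S" using that \<sigma> c(1) by (simp add: permutes_not_in)
      moreover have "\<sigma> i \<in> S" if "i \<in> S" using that \<sigma> by (simp add: permutes_in_image)
      ultimately show "i \<in> {i. i < (c \<circ> \<sigma>) i} \<longleftrightarrow> i \<in> {i\<in>S. i \<le> \<sigma> i} - {j}"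
        using c(2)[of i "\<sigma> i"] by (cases "i \<in> S") simp_all
    qed
    moreover have "j \<in> {i\<in>S. i \<le> \<sigma> i}" using j S by simp
    ultimately show ?thesis using S(1) card_Suc_Diff1[of "{i\<in>S. i \<le> \<sigma> i}" j] by (simp only: exceed_def) simp
  qed
  then show ?thesis
    by (subst setum_permutations_compose_left[OF c(1)])
      (auto simp: sum_distrib_left intro!: sum.cong simp flip: power_Suc)
qed

text \<open>With permutations of \<open>S\<close> sorted by support \<open>T\<close>, the weak
  excedances are the excedances and the \<open>card S - card T\<close> fixed points;
  \<open>sum_exceed_shift\<close> compares the two statistics.\<close>

lemma derange_poly_relation:
  assumes S: "finite S" "S \<noteq> {}"
  shows "(\<Sum>T\<in>Pow S. (fps_X - fps_X ^ (card S - card T)) * derange_poly T) = 0"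
proof -
  have "fps_X ^ card {i\<in>S. i \<le> \<sigma> i} = fps_X ^ (card S - card T) * (fps_X ^ exceed \<sigma> :: int fps)"
    if T: "T \<in> Pow S" and \<sigma>: "\<sigma> \<in> derange T" for T \<sigma>
  proof -
    have "{i\<in>S. i \<le> \<sigma> i} = (S - T) \<union> {i. i < \<sigma> i}"
      using derange_support[OF \<sigma>] T by (auto simp: order.order_iff_strict)
    moreover have "{i. i < \<sigma> i} \<subseteq> T" using derange_support[OF \<sigma>] by auto
    moreover have "finite T" using T S finite_subset by auto
    ultimately have "card {i\<in>S. i \<le> \<sigma> i} = card (S - T) + exceed \<sigma>"
      unfolding exceed_def using S by (metis card_Un_disjoint Diff_disjoint disjoint_iff finite_Diff finite_subset subsetD)
    also have "card (S - T) = card S - card T"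
      using \<open>finite T\<close> T by (simp add: card_Diff_subset)
    finally have "card {i\<in>S. i \<le> \<sigma> i} = (card S - card T) + exceed \<sigma>" .
    then show ?thesis by (simp add: power_add)
  qed
  then have "(\<Sum>\<sigma>\<in>{\<sigma>. \<sigma> permutes S}. fps_X ^ card {i\<in>S. i \<le> \<sigma> i} :: int fps)
     = (\<Sum>T\<in>Pow S. fps_X ^ (card S - card T) * derange_poly T)"
    unfolding permutations_by_support[OF S(1)] derange_poly_def by (simp add: sum_distrib_left)
  then show ?thesis
    using sum_exceed_shift[OF S] unfolding permutations_by_support[OF S(1)] derange_poly_def
    by (simp add: left_diff_distrib sum_subtractf sum_distrib_left)
qed

lemma derange_empty: "derange {} = {id}"
  by (auto simp: derange_def)

lemma top_poly_eq_derange_poly: "finite S \<Longrightarrow> top_poly S = derange_poly S"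
  by (rule subset_recursion_unique[OF top_poly_relation derange_poly_relation])
    (use fps_X_minus_one_nonzero in \<open>auto simp: top_poly_empty derange_poly_def derange_empty exceed_def\<close>)

text \<open>\<open>\<sigma>\<close> maps the positions where it decreases onto the excedances of its
  inverse, and a derangement increases or decreases at every point of \<open>T\<close>.\<close>

lemma exceed_inv:
  assumes T: "finite T" and \<sigma>: "\<sigma> \<in> derange T"
  shows "inv \<sigma> \<in> derange T" "exceed (inv \<sigma>) + exceed \<sigma> = card T"
proof -
  have p: "\<sigma> permutes T" using \<sigma> by (simp add: derange_def)
  have "inv \<sigma> i \<noteq> i" if "i \<in> T" for i
    using that \<sigma> p unfolding derange_def by (metis (mono_tags, lifting) mem_Collect_eq permutes_inverses(1))
  with p show "inv \<sigma> \<in> derange T" by (simp add: derange_def permutes_inv)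
  have "bij_betw \<sigma> {i. \<sigma> i < i} {i. i < inv \<sigma> i}"
    by (rule bij_betw_byWitness[where f' = "inv \<sigma>"]) (use p in \<open>auto simp: permutes_inverses\<close>)
  then have "exceed (inv \<sigma>) = card {i. \<sigma> i < i}"
    by (simp add: exceed_def bij_betw_same_card)
  moreover have "{i. \<sigma> i < i} \<union> {i. i < \<sigma> i} = T"
    using derange_support[OF \<sigma>] by auto
  moreover have "finite {i. \<sigma> i < i}" "finite {i. i < \<sigma> i}"
    using derange_support[OF \<sigma>] T by (auto intro: finite_subset[of _ T])
  moreover have "{i. \<sigma> i < i} \<inter> {i. i < \<sigma> i} = {}" by auto
  ultimately show "exceed (inv \<sigma>) + exceed \<sigma> = card T"
    unfolding exceed_def by (metis card_Un_disjoint)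
qed

text \<open>Passing to inverses turns \<open>j - exceed \<sigma>\<close> into
  \<open>(j - card T) + exceed \<sigma>\<close>; \<open>card T \<le> j\<close> keeps the natural
  subtraction exact.\<close>

lemma sum_derange_complement:
  assumes T: "finite T" "card T \<le> j"
  shows "(\<Sum>\<sigma>\<in>derange T. fps_X ^ (j - exceed \<sigma>)) = fps_X ^ (j - card T) * derange_poly T"
proof -
  have inv: "inv (inv \<sigma>) = \<sigma>" if "\<sigma> \<in> derange T" for \<sigma>
    using that by (auto simp: derange_def permutes_bij inv_inv_eq)
  have bij: "bij_betw inv (derange T) (derange T)"
    by (rule bij_betw_byWitness[where f' = inv]) (use inv exceed_inv[OF T(1)] in auto)
  have "(\<Sum>\<sigma>\<in>derange T. fps_X ^ (j - exceed \<sigma>)) = (\<Sum>\<sigma>\<in>derange T. fps_X ^ (j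
      - exceed (inv \<sigma>)) :: int fps)"
    by (rule sum.reindex_bij_betw[OF bij, symmetric])
  also have "\<dots> = (\<Sum>\<sigma>\<in>derange T. fps_X ^ (j - card T) * fps_X ^ exceed \<sigma>)"
  proof (rule sum.cong[OF refl])
    fix \<sigma> assume "\<sigma> \<in> derange T"
    from exceed_inv(2)[OF T(1) this] T(2) have "j - exceed (inv \<sigma>) = (j - card T) + exceed \<sigma>" by simp
    then show "fps_X ^ (j - exceed (inv \<sigma>)) = fps_X ^ (j - card T) * (fps_X ^ exceed \<sigma> :: int fps)"
      by (simp add: power_add)
  qed
  finally show ?thesis by (simp add: derange_poly_def sum_distrib_left)
qed

section \<open>The Stanley-Reisner ring\<close>

text \<open>The quotient by this set is the Stanley-Reisner ring of the order complex of
  \<open>V\<close>; variables outside \<open>V\<close> are killed too, so the set is an ideal among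
  all polynomials.\<close>

definition non_chain_polys :: "nat set set \<Rightarrow> ipoly set" where
  "non_chain_polys V = {p. \<forall>m\<in>Poly_Mapping.keys p. \<not> (Poly_Mapping.keys m \<subseteq> V \<and> is_chain (Poly_Mapping.keys m))}"

lemma non_chain_polys_mult:
  assumes "p \<in> non_chain_polys V"
  shows "c * p \<in> non_chain_polys V"
proof -
  have "\<not> (Poly_Mapping.keys m \<subseteq> V \<and> is_chain (Poly_Mapping.keys m))" if "m
      \<in> Poly_Mapping.keys (c * p)" for m
  proof -
    from that obtain a b where ab: "b \<in> Poly_Mapping.keys p" "m = a + b" by (rule keys_multE)
    with assms have "\<not> (Poly_Mapping.keys b \<subseteq> V \<and> is_chain (Poly_Mapping.keys b))"
      by (auto simp: non_chain_polys_def)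
    moreover have "Poly_Mapping.keys b \<subseteq> Poly_Mapping.keys m" by (simp add: ab keys_add_mono)
    ultimately show ?thesis unfolding is_chain_def by (meson subset_iff)
  qed
  then show ?thesis by (simp add: non_chain_polys_def)
qed

lemma add_subgroup_non_chain_polys: "add_subgroup (non_chain_polys V)"
proof -
  have "p + q \<in> non_chain_polys V" if "p \<in> non_chain_polys V" "q \<in> non_chain_polys V" for p q
    using that keys_add[of p q] unfolding non_chain_polys_def by (simp add: subset_iff) blast
  moreover have "0 \<in> non_chain_polys V" by (simp add: non_chain_polys_def)
  ultimately show ?thesis
    unfolding add_subgroup_def by (blast intro: non_chain_polys_mult)
qed

lemma pvar_pvar_non_chain:
  assumes "\<not> F \<subseteq> G" "\<not> G \<subseteq> F"
  shows "pvar F * pvar G \<in> non_chain_polys V"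
proof -
  have "\<not> is_chain (Poly_Mapping.keys (Poly_Mapping.single F 1 + Poly_Mapping.single G (1::nat)))"
    using assms unfolding keys_add_mono is_chain_def by auto
  then show ?thesis by (simp add: non_chain_polys_def pvar_def mult_single)
qed

section \<open>Homogeneous components\<close>

definition deg_part :: "nat \<Rightarrow> ipoly \<Rightarrow> ipoly" where
  "deg_part d p = Poly_Mapping.mapp (\<lambda>m c. if mono_deg m = d then c else 0) p"

lemma lookup_deg_part: "Poly_Mapping.lookup (deg_part d p) m = (if mono_deg m = d then Poly_Mapping.lookup p m else 0)"
  by (auto simp: deg_part_def lookup_mapp when_def in_keys_iff)

lemma keys_deg_part: "Poly_Mapping.keys (deg_part d p) = {m \<in> Poly_Mapping.keys p. mono_deg m = d}"
  by (auto simp: in_keys_iff lookup_deg_part split: if_splits)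

lemma deg_part_add: "deg_part d (p + q) = deg_part d p + deg_part d q"
  by (rule poly_mapping_eqI) (simp add: lookup_deg_part lookup_add)

lemma deg_part_diff: "deg_part d (p - q) = deg_part d p - deg_part d q"
  by (rule poly_mapping_eqI) (simp add: lookup_deg_part lookup_minus)

lemma deg_part_zero: "deg_part d 0 = 0"
  by (rule poly_mapping_eqI) (simp add: lookup_deg_part)

lemma deg_part_sum: "deg_part d (sum f A) = (\<Sum>a\<in>A. deg_part d (f a))"
  by (induction A rule: infinite_finite_induct) (simp_all add: deg_part_add deg_part_zero)

lemma deg_part_id:
  assumes "homog d p"
  shows "deg_part d p = p"
proof (rule poly_mapping_eqI)
  fix m show "Poly_Mapping.lookup (deg_part d p) m = Poly_Mapping.lookup p m"
    using assms by (cases "m \<in> Poly_Mapping.keys p") (auto simp: lookup_deg_part homog_def in_keys_iff)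
qed

lemma deg_part_eq_zero:
  assumes "\<And>m. m \<in> Poly_Mapping.keys p \<Longrightarrow> mono_deg m \<noteq> d"
  shows "deg_part d p = 0"
proof -
  have "Poly_Mapping.keys (deg_part d p) = {}" using assms unfolding keys_deg_part by blast
  then show ?thesis by simp
qed

lemma graded_deg_part: "poly_in V p \<Longrightarrow> graded V d 0 (deg_part d p)"
  by (simp add: graded_def poly_in_def keys_deg_part)

lemma deg_part_mult:
  assumes "homog 1 t"
  shows "deg_part (Suc d) (t * q) = t * deg_part d q" "deg_part 0 (t * q) = 0"
proof -
  have deg: "\<exists>b\<in>Poly_Mapping.keys p. mono_deg m = Suc (mono_deg b)" if "m \<in> Poly_Mapping.keys (t * p)" for m p
    using that
  proof (rule keys_multE)
    fix a b assume "a \<in> Poly_Mapping.keys t" "b \<in> Poly_Mapping.keys p" "m = a + b"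
    then show ?thesis using assms unfolding homog_def by (intro bexI[of _ b]) (auto simp: mono_deg_add)
  qed
  have "homog (Suc d) (t * deg_part d q)"
    unfolding homog_def using deg[of _ "deg_part d q"] by (auto simp: keys_deg_part)
  then have 1: "deg_part (Suc d) (t * deg_part d q) = t * deg_part d q" by (rule deg_part_id)
  have 2: "deg_part (Suc d) (t * (q - deg_part d q)) = 0"
  proof (rule deg_part_eq_zero)
    fix m assume "m \<in> Poly_Mapping.keys (t * (q - deg_part d q))"
    from deg[OF this] obtain b where b: "b \<in> Poly_Mapping.keys (q - deg_part d q)" "mono_deg m = Suc (mono_deg b)" ..
    then have "mono_deg b \<noteq> d" by (auto simp: in_keys_iff lookup_minus lookup_deg_part)
    with b show "mono_deg m \<noteq> Suc d" by simp
  qed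
  have "t * q = t * deg_part d q + t * (q - deg_part d q)" by (simp add: algebra_simps)
  then show "deg_part (Suc d) (t * q) = t * deg_part d q" using 1 2 by (simp only: deg_part_add) simp
  show "deg_part 0 (t * q) = 0"
    by (rule deg_part_eq_zero) (use deg in force)
qed

lemma deg_part_non_chain: "p \<in> non_chain_polys V \<Longrightarrow> deg_part d p \<in> non_chain_polys V"
  by (auto simp: non_chain_polys_def keys_deg_part)

section \<open>Counting exponent vectors\<close>

definition exponents :: "nat set \<Rightarrow> nat \<Rightarrow> (nat \<Rightarrow> nat) set" where
  "exponents S e = {\<alpha>. (\<forall>a. a \<notin> S \<longrightarrow> \<alpha> a = 0) \<and> sum \<alpha> S = e}"

lemma finite_exponents:
  assumes "finite S"
  shows "finite (exponents S e)"
proof (rule finite_subset)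
  show "exponents S e \<subseteq> {f. \<forall>x. (x \<in> S \<longrightarrow> f x
      \<in> {..e}) \<and> (x \<notin> S \<longrightarrow> f x = 0)}"
    using assms by (auto simp: exponents_def intro: member_le_sum)
  show "finite {f. \<forall>x. (x \<in> S \<longrightarrow> f x \<in> {..e}) \<and> (x \<notin> S \<longrightarrow> f x = 0)}"
    by (rule finite_set_of_finite_funs) (use assms in auto)
qed

lemma exponents_zero: "finite S \<Longrightarrow> exponents S 0 = {\<lambda>_. 0}"
  by (auto simp: exponents_def fun_eq_iff)

lemma exponents_increment:
  assumes "finite S" "a \<in> S" "\<alpha> \<in> exponents S e"
  shows "\<alpha>(a := Suc (\<alpha> a)) \<in> exponents S (Suc e)"
proof -
  have "sum (\<alpha>(a := Suc (\<alpha> a))) (S - {a}) = sum \<alpha> (S - {a})" by (rule sum.cong) auto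
  then show ?thesis using assms by (auto simp: exponents_def sum.remove[of S a])
qed

text \<open>Vectors vanishing at \<open>a\<close> live on \<open>S\<close>; the others are
  decremented at \<open>a\<close>.\<close>

lemma card_exponents_insert:
  assumes S: "finite S" "a \<notin> S"
  shows "card (exponents (insert a S) (Suc e)) = card (exponents S (Suc e)) + card (exponents (insert a S) e)"
proof -
  let ?pos = "{\<alpha> \<in> exponents (insert a S) (Suc e). \<alpha> a \<noteq> 0}"
  have zero: "{\<alpha> \<in> exponents (insert a S) (Suc e). \<alpha> a = 0} = exponents S (Suc e)"
    using S by (auto simp: exponents_def) (metis)
  have "bij_betw (\<lambda>\<alpha>. \<alpha>(a := Suc (\<alpha> a))) (exponents (insert a S) e) ?pos"
  proof (rule bij_betw_byWitness[where f' = "\<lambda>\<alpha>. \<alpha>(a := \<alpha> a - 1)"])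
    show "(\<lambda>\<alpha>. \<alpha>(a := Suc (\<alpha> a))) ` exponents (insert a S) e \<subseteq> ?pos"
      using exponents_increment[of "insert a S" a] S by auto
    show "(\<lambda>\<alpha>. \<alpha>(a := \<alpha> a - 1)) ` ?pos \<subseteq> exponents (insert a S) e"
    proof (rule image_subsetI)
      fix \<alpha> assume \<alpha>: "\<alpha> \<in> ?pos"
      have "sum (\<alpha>(a := \<alpha> a - 1)) S = sum \<alpha> S" using S by (intro sum.cong) auto
      with \<alpha> S show "\<alpha>(a := \<alpha> a - 1) \<in> exponents (insert a S) e" by (auto simp: exponents_def)
    qed
  qed auto
  then have pos: "card ?pos = card (exponents (insert a S) e)" by (simp add: bij_betw_same_card)
  have "exponents (insert a S) (Suc e) = {\<alpha> \<in> exponents (insert a S) (Suc e). \<alpha> a = 0} \<union> ?pos" by auto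
  then have "card (exponents (insert a S) (Suc e)) = card {\<alpha>
      \<in> exponents (insert a S) (Suc e). \<alpha> a = 0} + card ?pos"
    using finite_exponents[of "insert a S" "Suc e"] S by (subst card_Un_disjoint[symmetric]) auto
  then show ?thesis unfolding zero pos .
qed

definition exponent_series :: "nat set \<Rightarrow> int fps" where
  "exponent_series S = Abs_fps (\<lambda>e. int (card (exponents S e)))"

lemma exponent_series_inverse:
  assumes "finite S"
  shows "(1 - fps_X) ^ card S * exponent_series S = 1"
  using assms
proof (induction S rule: finite_induct)
  case empty
  have "exponents {} e = (if e = 0 then {\<lambda>_. 0} else {})" for e
    by (auto simp: exponents_def)
  then have "exponent_series {} = 1"
    by (intro fps_ext) (simp add: exponent_series_def)
  then show ?case by simp
next
  case (insert a S)
  have "(1 - fps_X) * exponent_series (insert a S) = exponent_series S"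
  proof (rule fps_ext)
    fix e show "fps_nth ((1 - fps_X) * exponent_series (insert a S)) e = fps_nth (exponent_series S) e"
      using insert.hyps exponents_zero
      by (cases e) (simp_all add: left_diff_distrib exponent_series_def card_exponents_insert)
  qed
  then have "(1 - fps_X) ^ card (insert a S) * exponent_series (insert a S) = (1 - fps_X) ^ card S * exponent_series S"
    using insert.hyps by (simp add: mult.assoc mult.left_commute)
  then show ?case using insert.IH by simp
qed

text \<open>For \<open>T\<close> other than \<open>S\<close>, exponent 0 contributes
  \<open>top_poly T\<close>, while the positive exponents add up to \<open>top_poly S\<close> by the
  recursion.\<close>

lemma boolean_fy_generating_function:
  assumes S: "finite S" "S \<noteq> {}"
  shows "(\<Sum>m\<in>fy_monoms S (card S). fps_X ^ mono_deg m) = (\<Sum>T\<in>Pow S. top_poly T)"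
proof -
  have card: "1 \<le> card S" using S by (simp add: Suc_leI card_gt_0_iff)
  let ?P = "{T. T \<subseteq> S \<and> card T < card S}"
  have fin: "finite ?P" using S by simp
  have P: "Pow S = insert S ?P"
    using card_subset_eq[OF S(1)] card_mono[OF S(1)] by (auto simp: order.strict_iff_order)
  have "(\<Sum>e<k. fps_X ^ e) = 1 + (\<Sum>e\<in>{Suc 0..<k}. fps_X ^ e :: int fps)" if "0 < k" for k
  proof -
    have "{..<k} = insert 0 {Suc 0..<k}" using that by auto
    then show ?thesis by simp
  qed
  then have "(\<Sum>T\<in>?P. top_poly T * (\<Sum>e<card S - card T. fps_X ^ e))
     = (\<Sum>T\<in>?P. top_poly T + top_poly T * (\<Sum>e\<in>{1..<card S - card T}. fps_X ^ e))"
    by (intro sum.cong[OF refl]) (simp add: distrib_left Suc_le_eq)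
  also have "\<dots> = sum top_poly ?P + top_poly S"
    unfolding sum.distrib top_poly_recursion[OF S, symmetric] ..
  also have "\<dots> = (\<Sum>T\<in>Pow S. top_poly T)"
    unfolding P using fin by simp
  finally show ?thesis unfolding fy_monoms_generating_function[OF S order_refl card] .
qed

text \<open>Summing the indicator vectors of the sets in \<open>level_monom n d v\<close> gives back \<open>v\<close> if \<open>v \<le> d\<close>.\<close>

definition level_monom :: "nat \<Rightarrow> nat \<Rightarrow> (nat \<Rightarrow> nat) \<Rightarrow> mono" where
  "level_monom n d v = (\<Sum>i\<in>{1..d}. Poly_Mapping.single {a\<in>{1..n}. i \<le> v a} 1)"

lemma keys_level_monom: "Poly_Mapping.keys (level_monom n d v) \<subseteq> (\<lambda>i. {a\<in>{1..n}. i \<le> v a}) ` {1..d}"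
proof -
  have "Poly_Mapping.keys (\<Sum>i\<in>A. Poly_Mapping.single (f i) (1::nat)) \<subseteq> f ` A" if "finite A"
    for A :: "nat set" and f :: "nat \<Rightarrow> nat set"
    using that by (induction A rule: finite_induct) (auto simp: keys_add_mono)
  then show ?thesis unfolding level_monom_def by simp
qed

lemma mono_deg_level_monom: "mono_deg (level_monom n d v) = d"
  by (simp add: level_monom_def mono_deg_msum msum_sum msum_single)

text \<open>The level sets through \<open>a\<close> have indices 1 to \<open>v a\<close>, so the
  monomial determines the vector; injectivity follows.\<close>

lemma level_monom_height:
  assumes "v a \<le> d" "a \<in> {1..n}"
  shows "msum (\<lambda>F. if a \<in> F then 1 else 0) (level_monom n d v) = v a"
proof -
  have "msum (\<lambda>F. if a \<in> F then 1 else 0) (level_monom n d v) = (\<Sum>i\<in>{1..d}. if i \<le> v a then 1 else 0)"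
    using assms unfolding level_monom_def msum_sum msum_single by (intro sum.cong) auto
  also have "\<dots> = card {i\<in>{1..d}. i \<le> v a}" by (simp add: sum.If_cases Int_def)
  also have "{i\<in>{1..d}. i \<le> v a} = {1..v a}" using assms by auto
  finally show ?thesis by simp
qed

text \<open>Attaining the bound \<open>d\<close> makes the level sets of index 1 to \<open>d\<close>
  nonempty, hence variables.\<close>

definition height_vectors :: "nat \<Rightarrow> nat \<Rightarrow> (nat \<Rightarrow> nat) set" where
  "height_vectors n d = PiE {1..n} (\<lambda>_. {..d}) - PiE {1..n} (\<lambda>_. {..<d})"

lemma card_height_vectors: "int (card (height_vectors n d)) = (int d + 1) ^ n - int d ^ n"
proof -
  have sub: "PiE {1..n} (\<lambda>_. {..<d}) \<subseteq> PiE {1..n} (\<lambda>_. {..d})" by (intro PiE_mono) auto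
  have "card (height_vectors n d) = Suc d ^ n - d ^ n"
    unfolding height_vectors_def using sub
    by (subst card_Diff_subset) (auto simp: card_PiE intro: finite_PiE)
  moreover have "d ^ n \<le> Suc d ^ n" by (rule power_mono) auto
  ultimately show ?thesis by (simp add: of_nat_diff add.commute)
qed

lemma inj_on_level_monom: "inj_on (level_monom n d) (height_vectors n d)"
proof (rule inj_onI)
  fix v w assume v: "v \<in> height_vectors n d" and w: "w \<in> height_vectors n d"
    and eq: "level_monom n d v = level_monom n d w"
  show "v = w"
  proof (rule PiE_ext)
    show "v \<in> PiE {1..n} (\<lambda>_. {..d})" "w \<in> PiE {1..n} (\<lambda>_. {..d})"
      using v w by (auto simp: height_vectors_def)
    fix a assume a: "a \<in> {1..n}"
    have "v a \<le> d" "w a \<le> d" using v w a by (auto simp: height_vectors_def)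
    then show "v a = w a" using level_monom_height[of v a d n] level_monom_height[of w a d n] a eq by simp
  qed
qed

lemma level_monom_chain:
  assumes "v \<in> height_vectors n d"
  shows "Poly_Mapping.keys (level_monom n d v) \<subseteq> Pow {1..n} - {{}}" "is_chain (Poly_Mapping.keys (level_monom n d v))"
proof -
  obtain a where a: "a \<in> {1..n}" "v a = d"
    using assms by (auto simp: height_vectors_def PiE_iff)
  then have "{a\<in>{1..n}. i \<le> v a} \<noteq> {}" if "i \<in> {1..d}" for i using that by auto
  then show "Poly_Mapping.keys (level_monom n d v) \<subseteq> Pow {1..n} - {{}}"
    using keys_level_monom[of n d v] by blast
  show "is_chain (Poly_Mapping.keys (level_monom n d v))"
    unfolding is_chain_def
  proof (intro ballI)
    fix F G assume "F \<in> Poly_Mapping.keys (level_monom n d v)" "G \<in> Poly_Mapping.keys (level_monom n d v)"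
    then obtain i j where "F = {a\<in>{1..n}. i \<le> v a}" "G = {a\<in>{1..n}. j \<le> v a}"
      using keys_level_monom[of n d v] by blast
    then show "F \<subseteq> G \<or> G \<subseteq> F" using linear[of i j] by auto
  qed
qed

section \<open>Independence of the monomials\<close>

context uniform_rank
begin

lemma finite_basis: "finite (basis d)"
proof -
  have "finite (fy_monoms {1..n} r)" using r_pos r_le by (intro finite_fy_monoms) auto
  then show ?thesis by (simp add: basis_def)
qed

text \<open>Multiples of quadratic generators are non-chain polynomials, so only the coefficients of
  the linear generators have to be collected.\<close>

lemma chow_ideal_decomposition:
  assumes "p \<in> J"
  shows "\<exists>q. (\<forall>a. poly_in V (q a)) \<and> p - (\<Sum>a\<in>{1..n}. up_sum L {a} * q a) \<in> non_chain_polys V"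
  using assms
proof (induction p rule: chow_ideal.induct)
  case zero
  show ?case by (intro exI[of _ "\<lambda>_. 0"]) (simp add: non_chain_polys_def)
next
  case (step g c p)
  then obtain q where q: "\<And>a. poly_in V (q a)" "p - (\<Sum>a\<in>{1..n}. up_sum L {a} * q a) \<in> non_chain_polys V"
    by blast
  from step.hyps(1) show ?case
  proof (cases rule: chow_gens_cases)
    case (1 F G)
    have "c * g \<in> non_chain_polys V"
      unfolding 1(5) by (intro non_chain_polys_mult pvar_pvar_non_chain 1)
    then have "c * g + (p - (\<Sum>a\<in>{1..n}. up_sum L {a} * q a)) \<in> non_chain_polys V"
      using q(2) add_subgroup_non_chain_polys unfolding add_subgroup_def by blast
    then show ?thesis using q(1) by (intro exI[of _ q]) (simp add: algebra_simps)
  next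
    case (2 b)
    define q' where "q' a = q a + (if a = b then c else 0)" for a
    have "(\<Sum>a\<in>{1..n}. up_sum L {a} * q' a)
      = (\<Sum>a\<in>{1..n}. up_sum L {a} * q a + (if a = b then up_sum L {b} * c else 0))"
      by (rule sum.cong) (auto simp: q'_def algebra_simps)
    also have "\<dots> = (\<Sum>a\<in>{1..n}. up_sum L {a} * q a) + up_sum L {b} * c"
      using 2(1) by (simp add: sum.distrib)
    finally have "c * g + p - (\<Sum>a\<in>{1..n}. up_sum L {a} * q' a) = p - (\<Sum>a\<in>{1..n}. up_sum L {a} * q a)"
      by (simp add: 2(2) algebra_simps)
    moreover have "poly_in V (q' a)" for a
      unfolding q'_def using q(1) step.hyps(2) by (intro poly_in_add) auto
    ultimately show ?thesis using q(2) by (intro exI[of _ q']) (simp only: simp_thms)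
  qed
qed

end

section \<open>Independence in the Boolean case\<close>

locale boolean_rank = uniform_rank n n for n
begin

lemma boolean_flats: "L = Pow {1..n}"
proof -
  have "card F \<le> n - 1" if "F \<subseteq> {1..n}" "F \<noteq> {1..n}" for F
  proof -
    have "F \<subset> {1..n}" using that by blast
    then have "card F < card {1..n}" by (intro psubset_card_mono) auto
    then show ?thesis by simp
  qed
  then show ?thesis by (auto simp: uniform_flats_def)
qed

definition theta_power :: "(nat \<Rightarrow> nat) \<Rightarrow> ipoly" where
  "theta_power \<alpha> = (\<Prod>a\<in>{1..n}. up_sum L {a} ^ \<alpha> a)"

definition theta_basis :: "nat \<times> mono \<times> (nat \<Rightarrow> nat) \<Rightarrow> ipoly" where
  "theta_basis = (\<lambda>(k, m, \<alpha>). theta_power \<alpha> * monom_poly m)"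

text \<open>The first component \<open>k\<close> is the degree of the monomial, so the index set \<open>{..<d}\<close> leaves out exactly
  the products without a linear form.\<close>

definition theta_index :: "nat set \<Rightarrow> nat \<Rightarrow> (nat \<times> mono \<times> (nat \<Rightarrow> nat)) set" where
  "theta_index A d = (SIGMA k:A. basis k \<times> exponents {1..n} (d - k))"

lemma finite_theta_index: "finite A \<Longrightarrow> finite (theta_index A d)"
  unfolding theta_index_def by (intro finite_SigmaI finite_cartesian_product finite_basis finite_exponents) auto

lemma theta_power_increment:
  assumes "a \<in> {1..n}"
  shows "theta_power (\<alpha>(a := Suc (\<alpha> a))) = up_sum L {a} * theta_power \<alpha>"
proof -
  have "theta_power \<beta> = up_sum L {a} ^ \<beta> a * (\<Prod>b\<in>{1..n}-{a}. up_sum L {b} ^ \<beta> b)" for \<beta>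
    unfolding theta_power_def using assms by (intro prod.remove) auto
  moreover have "(\<Prod>b\<in>{1..n}-{a}. up_sum L {b} ^ (\<alpha>(a := Suc (\<alpha> a))) b)
      = (\<Prod>b\<in>{1..n}-{a}. up_sum L {b} ^ \<alpha> b)"
    by (rule prod.cong) auto
  ultimately show ?thesis by (simp add: mult.assoc)
qed

text \<open>A linear factor raises one exponent, so only products with a positive exponent sum
  arise; hence the strict index set.\<close>

lemma theta_span_mult:
  assumes "int_span theta_basis (theta_index {..d} d) (non_chain_polys V) p" "a \<in> {1..n}"
  shows "int_span theta_basis (theta_index {..<Suc d} (Suc d)) (non_chain_polys V) (up_sum L {a} * p)"
  using assms(1)
proof (induction)
  case (base p)
  then show ?case by (intro int_span.base non_chain_polys_mult)
next
  case (step i p c)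
  obtain k m \<alpha> where i: "i = (k, m, \<alpha>)" by (cases i)
  then have *: "k \<le> d" "m \<in> basis k" "\<alpha> \<in> exponents {1..n} (d - k)"
    using step.hyps by (auto simp: theta_index_def)
  then have "(k, m, \<alpha>(a := Suc (\<alpha> a))) \<in> theta_index {..<Suc d} (Suc d)"
    using exponents_increment[of "{1..n}" a \<alpha> "d - k"] assms(2) by (auto simp: theta_index_def Suc_diff_le)
  from int_span.step[OF this step.IH, of c] show ?case
    using theta_power_increment[OF assms(2), of \<alpha>] by (simp add: i theta_basis_def algebra_simps)
qed

lemma homog_up_sum: "homog 1 (up_sum L {a})"
proof -
  have "graded V 1 0 (up_sum L {a})"
    unfolding up_sum_def by (intro graded_sum graded_pvar) auto
  then show ?thesis by (simp add: graded_iff)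
qed

text \<open>Modulo non-chain polynomials, \<open>p\<close> combines linear forms with coefficients
  of degree \<open>d - 1\<close>. Spanning in lower degrees is a hypothesis so that the lemma serves
  both inside the induction of \<open>theta_spanning\<close> and after it.\<close>

lemma chow_ideal_theta_span:
  assumes span: "\<And>e p. e < d \<Longrightarrow> graded V e 0 p \<Longrightarrow>
      int_span theta_basis (theta_index {..e} e) (non_chain_polys V) p"
    and p: "graded V d 0 p" "p \<in> J"
  shows "int_span theta_basis (theta_index {..<d} d) (non_chain_polys V) p"
proof -
  obtain q where q: "\<And>a. poly_in V (q a)" "p - (\<Sum>a\<in>{1..n}. up_sum L {a} * q a) \<in> non_chain_polys V"
    using chow_ideal_decomposition[OF p(2)] by blast
  \<comment> \<open>The coefficients \<open>q a\<close> need not be homogeneous; passing to degree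
    \<open>d\<close> parts repairs this.\<close>
  have "p - (\<Sum>a\<in>{1..n}. deg_part d (up_sum L {a} * q a)) \<in> non_chain_polys V"
    using deg_part_non_chain[OF q(2), of d] deg_part_id[of d p] p(1)
    by (simp add: deg_part_diff deg_part_sum graded_iff)
  from int_span.base[OF this]
  have rest: "int_span theta_basis (theta_index {..<d} d) (non_chain_polys V)
      (p - (\<Sum>a\<in>{1..n}. deg_part d (up_sum L {a} * q a)))" .
  have "int_span theta_basis (theta_index {..<d} d) (non_chain_polys V) (deg_part d (up_sum L {a} * q a))"
    if "a \<in> {1..n}" for a
  proof (cases d)
    case 0
    then show ?thesis
      by (auto simp: deg_part_mult[OF homog_up_sum] non_chain_polys_def intro!: int_span.base)
  next
    case (Suc e)
    then have "int_span theta_basis (theta_index {..e} e) (non_chain_polys V) (deg_part e (q a))"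
      using q(1) by (intro span graded_deg_part) auto
    from theta_span_mult[OF this that] show ?thesis
      by (simp only: Suc deg_part_mult[OF homog_up_sum])
  qed
  then have "int_span theta_basis (theta_index {..<d} d) (non_chain_polys V)
      (\<Sum>a\<in>{1..n}. deg_part d (up_sum L {a} * q a))"
    by (rule int_span_sum[OF add_subgroup_non_chain_polys])
  from int_span_add[OF add_subgroup_non_chain_polys this rest] show ?thesis by simp
qed

lemma theta_basis_zero:
  assumes "m \<in> basis d"
  shows "(d, m, \<lambda>_. 0) \<in> theta_index {..d} d" "theta_basis (d, m, \<lambda>_. 0) = monom_poly m"
  using assms exponents_zero[of "{1..n}"] by (auto simp: theta_index_def theta_basis_def theta_power_def)

lemma graded_basis_sum: "graded V d 0 (\<Sum>m\<in>basis d. of_int (c m) * monom_poly m)"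
proof (rule graded_sum)
  fix m assume "m \<in> basis d"
  then have "Poly_Mapping.keys m \<subseteq> V" "mono_deg m = d"
    using fy_monoms_keys by (auto simp: basis_def)
  then show "graded V d 0 (of_int (c m) * monom_poly m)"
    using graded_monom[of m V] by (auto intro!: graded_of_int elim: graded_weaken)
qed

text \<open>A graded Nakayama argument: the basis monomials span modulo the Chow ideal, and the
  error lies in the ideal, where lower degrees suffice.\<close>

lemma theta_spanning:
  "graded V d 0 p \<Longrightarrow> int_span theta_basis (theta_index {..d} d) (non_chain_polys V) p"
proof (induction d arbitrary: p rule: less_induct)
  case (less d)
  from int_span_imp_sum[OF finite_basis spanning[OF less.prems]] obtain c where
    c: "p - (\<Sum>m\<in>basis d. of_int (c m) * monom_poly m) \<in> J" by blast
  have "int_span theta_basis (theta_index {..<d} d) (non_chain_polys V) (p - (\<Sum>m\<in>basis d. of_int (c m) * monom_poly m))"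
    by (intro chow_ideal_theta_span less.IH graded_diff less.prems graded_basis_sum c)
  then have 1: "int_span theta_basis (theta_index {..d} d) (non_chain_polys V) (p
      - (\<Sum>m\<in>basis d. of_int (c m) * monom_poly m))"
    by (rule int_span_mono) (auto simp: theta_index_def)
  have 2: "int_span theta_basis (theta_index {..d} d) (non_chain_polys V) (\<Sum>m\<in>basis d. of_int (c m) * monom_poly m)"
  proof (rule int_span_sum[OF add_subgroup_non_chain_polys int_span_scale[OF add_subgroup_non_chain_polys]])
    fix m assume "m \<in> basis d"
    from int_span_generator[OF add_subgroup_non_chain_polys theta_basis_zero(1)[OF this], of theta_basis]
    show "int_span theta_basis (theta_index {..d} d) (non_chain_polys V) (monom_poly m)"
      by (simp only: theta_basis_zero(2)[OF \<open>m \<in> basis d\<close>])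
  qed
  from int_span_add[OF add_subgroup_non_chain_polys 1 2] show ?case by simp
qed

text \<open>Multiplying the Worpitzky form by \<open>exponent_series\<close> cancels
  \<open>n\<close> factors \<open>1 - fps_X\<close>; the one that remains takes differences of
  consecutive powers.\<close>

lemma card_theta_index: "int (card (theta_index {..d} d)) = (int d + 1) ^ n - (if d = 0 then 0 else int d ^ n)"
proof -
  have n: "{1..n} \<noteq> {}" "finite {1..n}" "card {1..n} = n" using r_pos by auto
  have fin: "finite (fy_monoms {1..n} n)" using r_pos by (intro finite_fy_monoms) auto
  let ?F = "\<Sum>m\<in>fy_monoms {1..n} n. fps_X ^ mono_deg m :: int fps"
  have F: "fps_nth ?F k = int (card (basis k))" for k
  proof -
    have "fps_nth ?F k = (\<Sum>m\<in>fy_monoms {1..n} n. if mono_deg m = k then 1 else 0)"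
      by (auto simp: fps_sum_nth intro!: sum.cong)
    then show ?thesis using fin by (simp add: basis_def sum.If_cases Int_def)
  qed
  have "?F = (1 - fps_X) ^ Suc n * power_series n"
    using boolean_fy_generating_function[OF n(2,1)] sum_top_poly_worpitzky[OF n(2)] n(3) by simp
  then have "?F * exponent_series {1..n} = (1 - fps_X) * power_series n * ((1 - fps_X) ^ n * exponent_series {1..n})"
    by (simp add: ac_simps)
  also have "(1 - fps_X) ^ n * exponent_series {1..n} = 1"
    using exponent_series_inverse[OF n(2)] n(3) by simp
  finally have "fps_nth (?F * exponent_series {1..n}) d = fps_nth ((1 - fps_X) * power_series n) d" by simp
  moreover have "fps_nth ((1 - fps_X) * power_series n) d = (int d + 1) ^ n - (if d = 0 then 0 else int d ^ n)"
    by (cases d) (auto simp: left_diff_distrib power_series_def add.commute)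
  moreover have "fps_nth (?F * exponent_series {1..n}) d = int (card (theta_index {..d} d))"
  proof -
    have "card (theta_index {..d} d) = (\<Sum>k\<in>{..d}. card (basis k) * card (exponents {1..n} (d - k)))"
      unfolding theta_index_def
      by (subst card_SigmaI) (auto simp: finite_basis finite_exponents card_cartesian_product)
    then show ?thesis
      by (simp only: fps_mult_nth F exponent_series_def fps_nth_Abs_fps atMost_atLeast0 of_nat_sum of_nat_mult)
  qed
  ultimately show ?thesis by simp
qed

text \<open>The products span the independent chain monomials and are no more numerous, so they are
  independent too; a relation modulo the Chow ideal extends to one among them.\<close>

lemma basis_independent_boolean:
  assumes rel: "(\<Sum>m\<in>basis d. of_int (c m) * monom_poly m) \<in> J" and m0: "m0 \<in> basis d"
  shows "c m0 = 0"
proof -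
  let ?K = "non_chain_polys V"
  let ?M = "level_monom n d ` height_vectors n d"
  have fin: "finite (height_vectors n d)" by (auto simp: height_vectors_def intro: finite_PiE)
  have card: "card (theta_index {..d} d) \<le> card ?M"
  proof -
    have "int (card ?M) = (int d + 1) ^ n - int d ^ n"
      by (simp add: card_image inj_on_level_monom card_height_vectors)
    moreover have "int (card (theta_index {..d} d)) = (int d + 1) ^ n - int d ^ n"
      using card_theta_index[of d] r_pos by (auto simp: power_0_left)
    ultimately show ?thesis by linarith
  qed
  have M: "Poly_Mapping.keys m \<subseteq> V \<and> is_chain (Poly_Mapping.keys m) \<and> mono_deg m = d" if "m \<in> ?M" for m
    using that level_monom_chain mono_deg_level_monom unfolding boolean_flats by blast
  have span: "\<exists>a. monom_poly m - (\<Sum>i\<in>theta_index {..d} d. of_int (a i) * theta_basis i) \<in> ?K"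
      if "m \<in> ?M" for m
  proof -
    have "graded V d 0 (monom_poly m)"
      using M[OF that] graded_monom[of m V] by (auto elim: graded_weaken)
    from int_span_imp_sum[OF finite_theta_index theta_spanning[OF this]] show ?thesis by simp
  qed
  have indep: "\<forall>m\<in>?M. e m = 0" if e: "(\<Sum>m\<in>?M. of_int (e m) * monom_poly m) \<in> ?K" for e
  proof
    fix m assume m: "m \<in> ?M"
    have "Poly_Mapping.lookup (\<Sum>m\<in>?M. of_int (e m) * monom_poly m) m = (\<Sum>m'\<in>?M. if m' = m then e m else 0)"
      unfolding lookup_sum
      by (rule sum.cong) (auto simp: mult_single lookup_single when_def simp flip: single_of_int)
    also have "\<dots> = e m" using m fin by simp
    finally have "Poly_Mapping.lookup (\<Sum>m\<in>?M. of_int (e m) * monom_poly m) m = e m" .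
    moreover have "m \<notin> Poly_Mapping.keys (\<Sum>m\<in>?M. of_int (e m) * monom_poly m)"
      using e M[OF m] unfolding non_chain_polys_def by blast
    ultimately show "e m = 0" by (simp add: in_keys_iff)
  qed
  have "int_span theta_basis (theta_index {..<d} d) ?K (\<Sum>m\<in>basis d. of_int (c m) * monom_poly m)"
    by (intro chow_ideal_theta_span theta_spanning graded_basis_sum rel)
  from int_span_imp_sum[OF finite_theta_index this] obtain b where
    b: "(\<Sum>m\<in>basis d. of_int (c m) * monom_poly m)
        - (\<Sum>i\<in>theta_index {..<d} d. of_int (b i) * theta_basis i) \<in> ?K"
    by auto
  \<comment> \<open>Bare monomials have \<open>k = d\<close>, the other products
    \<open>k < d\<close>, so the two families of coefficients do not interfere.\<close>
  define c' where "c' = (\<lambda>(k, m, \<alpha>). if k = d then c m else - b (k, m, \<alpha>))"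
  have idx: "theta_index {..d} d = (\<lambda>m. (d, m, \<lambda>_. 0)) ` basis d \<union> theta_index {..<d} d"
    using exponents_zero[of "{1..n}"] by (auto simp: theta_index_def image_iff le_less)
  have "(\<Sum>i\<in>theta_index {..d} d. of_int (c' i) * theta_basis i)
    = (\<Sum>i\<in>(\<lambda>m. (d, m, \<lambda>_. 0)) ` basis d. of_int (c' i) * theta_basis i)
        + (\<Sum>i\<in>theta_index {..<d} d. of_int (c' i) * theta_basis i)"
    unfolding idx by (intro sum.union_disjoint finite_imageI finite_basis finite_theta_index) (auto simp: theta_index_def)
  also have "(\<Sum>i\<in>(\<lambda>m. (d, m, \<lambda>_. 0)) ` basis d. of_int (c' i) * theta_basis i)
      = (\<Sum>m\<in>basis d. of_int (c m) * monom_poly m)"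
    by (subst sum.reindex) (auto simp: inj_on_def c'_def theta_basis_zero(2) intro!: sum.cong)
  also have "(\<Sum>i\<in>theta_index {..<d} d. of_int (c' i) * theta_basis i) =
      - (\<Sum>i\<in>theta_index {..<d} d. of_int (b i) * theta_basis i)"
    unfolding sum_negf[symmetric] by (rule sum.cong) (auto simp: theta_index_def c'_def)
  finally have "(\<Sum>i\<in>theta_index {..d} d. of_int (c' i) * theta_basis i) \<in> ?K" using b by simp
  from independent_of_count[OF add_subgroup_non_chain_polys finite_theta_index finite_imageI[OF fin] card span indep this
      theta_basis_zero(1)[OF m0]]
  have "c' (d, m0, \<lambda>_. 0) = 0" by simp
  then show ?thesis by (simp add: c'_def)
qed

text \<open>The instance of \<open>nilpotent\<close> at rank \<open>n\<close> with \<open>F\<close>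
  as \<open>H\<close> and [n] as \<open>G\<close>: both terms of the minimum are
  \<open>n - card F\<close>.\<close>

lemma annihilated_by_top_power:
  assumes "F \<in> V" "F \<noteq> {1..n}" "n - card F \<le> k"
  shows "pvar F * pvar {1..n} ^ k \<in> J"
proof -
  have "F \<subseteq> {1..n}" "finite F" "F \<noteq> {}" using assms flat_subset finite_flat by auto
  then have "pvar0 F * up_sum L {1..n} ^ k \<in> J"
    using assms top_flat by (intro nilpotent) auto
  moreover have "{H \<in> V. {1..n} \<subseteq> H} = {{1..n}}" using top_flat flat_subset by blast
  then have "up_sum L {1..n} = pvar {1..n}" by (simp add: up_sum_def)
  ultimately show ?thesis using \<open>F \<noteq> {}\<close> by (simp add: pvar0_def)
qed

end

section \<open>Transfer of independence from rank \<open>n\<close> to rank \<open>r\<close>, and the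
  rank computation\<close>

context uniform_rank
begin

sublocale bool: boolean_rank n
  by unfold_locales (use r_pos r_le in auto)

text \<open>Multiplication by this power of the top variable maps the Chow ring of rank \<open>r\<close> into that of
  rank \<open>n\<close>, because it kills the variables of all proper flats of size at least \<open>r\<close>.\<close>

lemma top_power_mult_chow_ideal:
  assumes "p \<in> J"
  shows "pvar {1..n} ^ (n - r) * p \<in> chow_ideal (uniform_flats n n) {}"
  using assms
proof (induction p rule: chow_ideal.induct)
  case zero
  show ?case by (simp add: chow_ideal.zero)
next
  case (step g c p)
  let ?V = "uniform_flats n n - {{}}"
  let ?E = "pvar {1..n} ^ (n - r)"
  have sub: "V \<subseteq> ?V" using flat_subset unfolding bool.boolean_flats by blast
  have c: "poly_in ?V c" using step.hyps(2) sub unfolding poly_in_def by blast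
  have E: "poly_in ?V ?E" using bool.top_flat by (intro poly_in_power poly_in_pvar)
  have "?E * g \<in> chow_ideal (uniform_flats n n) {}"
    using step.hyps(1)
  proof (cases rule: chow_gens_cases)
    case (1 F G)
    then have "pvar F * pvar G \<in> chow_ideal (uniform_flats n n) {}"
      using sub by (intro incomparable_in_chow_ideal) blast+
    then show ?thesis unfolding 1(5) using E by (rule chow_ideal_mult)
  next
    case (2 a)
    \<comment> \<open>The linear forms at \<open>a\<close> in the two lattices differ by these
      flats, all of size at least \<open>r\<close>.\<close>
    let ?D = "{H \<in> ?V - V. {a} \<subseteq> H}"
    have finL: "finite V" "finite ?V" using finite_L bool.finite_L by auto
    have "{H \<in> ?V. {a} \<subseteq> H} = {H \<in> V. {a} \<subseteq> H} \<union> ?D" using sub by blast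
    then have "up_sum (uniform_flats n n) {a} = up_sum L {a} + sum pvar ?D"
      unfolding up_sum_def using finL by (simp only:) (rule sum.union_disjoint, auto)
    then have eq: "?E * g = ?E * up_sum (uniform_flats n n) {a} - (\<Sum>F\<in>?D. pvar F * ?E)"
      by (simp add: 2(2) algebra_simps sum_distrib_left)
    have "pvar F * ?E \<in> chow_ideal (uniform_flats n n) {}" if "F \<in> ?D" for F
    proof (rule bool.annihilated_by_top_power)
      show "F \<in> ?V" using that by blast
      have F: "F \<subseteq> {1..n}" "F \<noteq> {}" "F \<notin> L" using that bool.flat_subset by auto
      then show "F \<noteq> {1..n}" "n - card F \<le> n - r" by (auto simp: uniform_flats_def)
    qed
    then show ?thesis
      unfolding eq
      by (rule chow_ideal_diff[OF chow_ideal_mult[OF bool.linear_in_J[OF 2(1)] E] chow_ideal_sum])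
  qed
  from chow_ideal_add[OF chow_ideal_mult[OF this c] step.IH] show ?case
    by (simp add: algebra_simps)
qed

text \<open>At [n] the bound rises from \<open>r\<close> to \<open>n\<close>, exactly by the added
  exponent; proper flats have size below \<open>r\<close>, so their bound is unchanged. If [n] is
  absent from \<open>m\<close>, \<open>card G < r\<close> gives the new bound.\<close>

lemma top_power_mult_basis:
  assumes "m \<in> basis d"
  shows "m + Poly_Mapping.single {1..n} (n - r) \<in> bool.basis (d + (n - r))"
proof -
  let ?m = "m + Poly_Mapping.single {1..n} (n - r)"
  have m: "m \<in> fy_monoms {1..n} r" "mono_deg m = d" using assms by (auto simp: basis_def)
  have keys: "Poly_Mapping.keys ?m = Poly_Mapping.keys m \<union> (if n - r = 0 then {} else {{1..n}})"
    by (simp add: keys_add_mono)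
  have m1: "F \<subseteq> {1..n}" "F \<noteq> {}" "F \<noteq> {1..n} \<Longrightarrow> card F < r" if "F
      \<in> Poly_Mapping.keys m" for F
    using m(1) that unfolding fy_monoms_def by blast+
  have m2: "is_chain (Poly_Mapping.keys m)" using m(1) unfolding fy_monoms_def by blast
  have m3: "Poly_Mapping.lookup m F + card G < min (card F) r"
    if "F \<in> Poly_Mapping.keys m" "G \<in> insert {} (Poly_Mapping.keys m)" "G \<subset> F" for F G
    using m(1) that unfolding fy_monoms_def by blast
  have top: "{1..n} \<noteq> {}" using r_pos r_le by auto
  have 0: "F \<in> Poly_Mapping.keys m \<or> F = {1..n}" if "F \<in> Poly_Mapping.keys ?m" for F
    using that keys by (auto split: if_splits)
  have 1: "F \<subseteq> {1..n} \<and> F \<noteq> {} \<and> (F \<noteq> {1..n} \<longrightarrow> card F < n)"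
      if "F \<in> Poly_Mapping.keys ?m" for F
    using 0[OF that] m1[of F] top r_le by (metis order_less_le_trans order_refl)
  have 2: "is_chain (Poly_Mapping.keys ?m)"
    unfolding is_chain_def using 0 1 m2 unfolding is_chain_def by metis
  have 3: "Poly_Mapping.lookup ?m F + card G < min (card F) n"
    if F: "F \<in> Poly_Mapping.keys ?m" and G: "G \<in> insert {} (Poly_Mapping.keys ?m)" "G \<subset> F" for F G
  proof -
    have "G \<noteq> {1..n}" using G(2) 1[OF F] by blast
    then have G': "G \<in> insert {} (Poly_Mapping.keys m)" using G(1) 0 by blast
    show ?thesis
    proof (cases "F = {1..n}")
      case False
      then have "F \<in> Poly_Mapping.keys m" using 0[OF F] by blast
      from m3[OF this G' G(2)] False r_le show ?thesis
        by (simp add: lookup_add lookup_single when_def)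
    next
      case True
      have "Poly_Mapping.lookup m {1..n} + card G < r"
      proof (cases "{1..n} \<in> Poly_Mapping.keys m")
        case True
        from m3[OF this G'] G(2) \<open>F = {1..n}\<close> show ?thesis by simp
      next
        case False
        moreover have "card G < r"
          using G' m1(3)[of G] \<open>G \<noteq> {1..n}\<close> r_pos by auto
        ultimately show ?thesis by (simp add: in_keys_iff)
      qed
      then show ?thesis using True r_le by (simp add: lookup_add)
    qed
  qed
  have "?m \<in> fy_monoms {1..n} n" unfolding fy_monoms_def using 1 2 3 by blast
  then show ?thesis using m(2) by (simp add: bool.basis_def mono_deg_add mono_deg_single)
qed

lemma basis_independent:
  assumes rel: "(\<Sum>m\<in>basis d. of_int (c m) * monom_poly m) \<in> J" and m0: "m0 \<in> basis d"
  shows "c m0 = 0"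
proof -
  let ?s = "Poly_Mapping.single {1..n} (n - r)"
  \<comment> \<open>Extended by 0 to the Boolean monomials that do not come from rank
    \<open>r\<close>.\<close>
  define c' where "c' m = (if m \<in> (\<lambda>m. m + ?s) ` basis d then c (m - ?s) else 0)" for m
  have inj: "inj_on (\<lambda>m. m + ?s) (basis d)" by (simp add: inj_on_def)
  have "(\<Sum>m\<in>bool.basis (d + (n - r)). of_int (c' m) * monom_poly m)
     = (\<Sum>m\<in>(\<lambda>m. m + ?s) ` basis d. of_int (c' m) * monom_poly m)"
    using top_power_mult_basis bool.finite_basis by (intro sum.mono_neutral_right) (auto simp: c'_def)
  also have "\<dots> = (\<Sum>m\<in>basis d. of_int (c m) * monom_poly (m + ?s))"
    unfolding sum.reindex[OF inj] by (rule sum.cong) (auto simp: c'_def)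
  also have "\<dots> = pvar {1..n} ^ (n - r) * (\<Sum>m\<in>basis d. of_int (c m) * monom_poly m)"
  proof -
    have "monom_poly (m + ?s) = pvar {1..n} ^ (n - r) * monom_poly m" for m
      unfolding pvar_power by (simp add: mult_single add.commute)
    then show ?thesis by (simp add: sum_distrib_left mult.left_commute)
  qed
  also have "\<dots> \<in> chow_ideal (uniform_flats n n) {}" by (rule top_power_mult_chow_ideal[OF rel])
  finally have "c' (m0 + ?s) = 0"
    by (rule bool.basis_independent_boolean) (rule top_power_mult_basis[OF m0])
  then show ?thesis using m0 by (simp add: c'_def)
qed

text \<open>The basis attains the supremum; a larger set of polynomials is spanned by fewer elements
  modulo the ideal, hence dependent.\<close>

lemma chow_rank_eq: "chow_rank L {} d = card (basis d)"
  unfolding chow_rank_def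
proof (rule cSup_eq_maximum)
  let ?S = "monom_poly ` basis d"
  have inj: "inj_on monom_poly (basis d)"
    by (rule inj_onI) (metis lookup_single_eq lookup_single_not_eq zero_neq_one)
  have hom: "poly_in V p \<and> homog d p" if p: "p \<in> ?S" for p
  proof -
    from p obtain m where m: "m \<in> fy_monoms {1..n} r" "mono_deg m = d" "p = monom_poly m"
      unfolding basis_def by blast
    then show ?thesis using fy_monoms_keys[OF m(1)] by (simp add: poly_in_def homog_def)
  qed
  have indep: "c p = 0" if "(\<Sum>p\<in>?S. of_int (c p) * p) \<in> J" "p \<in> ?S" for c :: "ipoly \<Rightarrow> int" and p
  proof -
    have "(\<Sum>p\<in>?S. of_int (c p) * p) = (\<Sum>m\<in>basis d. of_int (c (monom_poly m)) * monom_poly m)"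
      unfolding sum.reindex[OF inj] by simp
    then show ?thesis using basis_independent[of "\<lambda>m. c (monom_poly m)"] that by auto
  qed
  have fin: "finite ?S" "card ?S = card (basis d)"
    using finite_basis inj by (auto simp: card_image)
  show "card (basis d) \<in> {card S | S. finite S \<and> (\<forall>p\<in>S. poly_in V p \<and> homog d p) \<and>
      (\<forall>c :: ipoly \<Rightarrow> int. (\<Sum>p\<in>S. of_int (c p) * p)
          \<in> J \<longrightarrow> (\<forall>p\<in>S. c p = 0))}"
    unfolding mem_Collect_eq
    by (intro exI[of _ ?S] conjI ballI allI impI fin(1) fin(2)[symmetric] indep hom[THEN conjunct1] hom[THEN conjunct2])
next
  fix x assume "x \<in> {card S | S. finite S \<and> (\<forall>p\<in>S. poly_in V p \<and> homog d p) \<and>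
      (\<forall>c :: ipoly \<Rightarrow> int. (\<Sum>p\<in>S. of_int (c p) * p)
          \<in> J \<longrightarrow> (\<forall>p\<in>S. c p = 0))}"
  then obtain S where S: "x = card S" "finite S" "\<forall>p\<in>S. poly_in V p \<and> homog d p"
    and indep: "\<And>c :: ipoly \<Rightarrow> int. (\<Sum>p\<in>S. of_int (c p) * p) \<in> J \<Longrightarrow>
        \<forall>p\<in>S. c p = 0" by blast
  show "x \<le> card (basis d)"
  proof (rule ccontr)
    assume "\<not> x \<le> card (basis d)"
    then have "\<exists>c. (\<exists>p\<in>S. c p \<noteq> 0) \<and> (\<Sum>p\<in>S. of_int (c p) * p) \<in> J"
      using S int_span_imp_sum[OF finite_basis spanning[of d 0]]
      by (intro spanned_imp_dependent[OF add_subgroup_chow_ideal finite_basis[of d], of S "\<lambda>p. p" monom_poly])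
        (auto simp: graded_iff)
    with indep show False by blast
  qed
qed

lemma chow_hilbert_eq_fy: "chow_hilbert L {} = (\<Sum>m\<in>fy_monoms {1..n} r. fps_X ^ mono_deg m)"
proof (rule fps_ext)
  fix k
  have "finite (fy_monoms {1..n} r)" using r_pos r_le by (intro finite_fy_monoms) auto
  moreover have "fps_nth (\<Sum>m\<in>fy_monoms {1..n} r. fps_X ^ mono_deg m :: int fps) k
      = (\<Sum>m\<in>fy_monoms {1..n} r. if mono_deg m = k then 1 else 0)"
    by (auto simp: fps_sum_nth intro!: sum.cong)
  ultimately show "fps_nth (chow_hilbert L {}) k = fps_nth (\<Sum>m\<in>fy_monoms {1..n} r. fps_X ^ mono_deg m) k"
    by (simp add: chow_hilbert_def chow_rank_eq basis_def sum.If_cases Int_def)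
qed

end

section \<open>The Hilbert series\<close>

lemma exc_eq_exceed:
  assumes "\<sigma> permutes {1..n}"
  shows "exc n \<sigma> = exceed \<sigma>"
proof -
  have "i \<in> {1..n}" if "i < \<sigma> i" for i
    using assms that by (metis nat_neq_iff permutes_not_in)
  then have "{i\<in>{1..n}. \<sigma> i > i} = {i. i < \<sigma> i}" by blast
  then show ?thesis by (simp only: exc_def exceed_def)
qed

lemma nfix_derange:
  assumes "\<sigma> \<in> derange T" "T \<subseteq> {1..n}"
  shows "nfix n \<sigma> = n - card T"
proof -
  have "{i\<in>{1..n}. \<sigma> i = i} = {1..n} - T"
    using derange_support[OF assms(1)] assms(2) by auto
  then show ?thesis
    using assms(2) by (simp add: nfix_def card_Diff_subset finite_subset)
qed

text \<open>A permutation with support \<open>T\<close> has \<open>n - card T\<close> fixed points,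
  so membership reads \<open>card T \<le> j\<close>; inversion handles the complementary
  exponent.\<close>

lemma sum_F_set:
  assumes "j \<le> n"
  shows "(\<Sum>\<sigma>\<in>F_set n (n - j). fps_X ^ (j - exc n \<sigma>))
    = (\<Sum>T\<in>Pow {1..n}. if card T \<le> j then fps_X ^ (j - card T) * top_poly T else 0)"
proof -
  have "(\<Sum>\<sigma>\<in>F_set n (n - j). fps_X ^ (j - exc n \<sigma>))
      = (\<Sum>\<sigma>\<in>{\<sigma>. \<sigma> permutes {1..n}}. if n - j \<le> nfix n \<sigma> then fps_X ^ (j
          - exceed \<sigma>) else (0 :: int fps))"
    unfolding F_set_def
    by (rule sum.mono_neutral_cong_left) (auto simp: finite_permutations exc_eq_exceed)
  also have "\<dots> = (\<Sum>T\<in>Pow {1..n}. \<Sum>\<sigma>\<in>derange T. if n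
      - j \<le> nfix n \<sigma> then fps_X ^ (j - exceed \<sigma>) else 0)"
    by (rule permutations_by_support) simp
  also have "\<dots> = (\<Sum>T\<in>Pow {1..n}. if card T \<le> j then fps_X ^ (j - card T) * top_poly T else 0)"
  proof (rule sum.cong[OF refl])
    fix T assume T: "T \<in> Pow {1..n}"
    then have fin: "finite T" "card T \<le> n"
      using finite_subset[of T "{1..n}"] card_mono[of "{1..n}" T] by auto
    have "(\<Sum>\<sigma>\<in>derange T. if n - j \<le> nfix n \<sigma> then fps_X ^ (j - exceed \<sigma>) else (0 :: int fps))
      = (\<Sum>\<sigma>\<in>derange T. if card T \<le> j then fps_X ^ (j - exceed \<sigma>) else 0)"
    proof (rule sum.cong[OF refl])
      fix \<sigma> assume "\<sigma> \<in> derange T"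
      then have "nfix n \<sigma> = n - card T" using T by (intro nfix_derange) auto
      then have "n - j \<le> nfix n \<sigma> \<longleftrightarrow> card T \<le> j" using fin assms by auto
      then show "(if n - j \<le> nfix n \<sigma> then fps_X ^ (j - exceed \<sigma>) else (0 :: int fps))
        = (if card T \<le> j then fps_X ^ (j - exceed \<sigma>) else 0)" by simp
    qed
    then show "(\<Sum>\<sigma>\<in>derange T. if n - j \<le> nfix n \<sigma> then fps_X ^ (j - exceed \<sigma>) else 0)
        = (if card T \<le> j then fps_X ^ (j - card T) * top_poly T else 0)"
      using sum_derange_complement[OF fin(1), of j] top_poly_eq_derange_poly[OF fin(1)] by simp
  qed
  finally show ?thesis .
qed

text \<open>Sets with \<open>card T \<ge> r\<close> contribute empty geometric sums; including them
  gives all ranks one index set, so ranks can be subtracted termwise.\<close>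

lemma chow_hilbert_uniform:
  assumes "1 \<le> r" "r \<le> n"
  shows "chow_hilbert (uniform_flats n r) {} = (\<Sum>T\<in>Pow {1..n}. top_poly T * (\<Sum>e<r - card T. fps_X ^ e))"
proof -
  interpret uniform_rank n r by unfold_locales fact+
  have "chow_hilbert (uniform_flats n r) {}
      = (\<Sum>T\<in>{T. T \<subseteq> {1..n} \<and> card T < r}. top_poly T * (\<Sum>e<r - card T. fps_X ^ e))"
    unfolding chow_hilbert_eq_fy using assms by (intro fy_monoms_generating_function) auto
  also have "\<dots> = (\<Sum>T\<in>Pow {1..n}. top_poly T * (\<Sum>e<r - card T. fps_X ^ e))"
    by (rule sum.mono_neutral_left) (auto simp: not_less)
  finally show ?thesis .
qed

lemma chow_hilbert_boolean:
  assumes "1 \<le> n"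
  shows "chow_hilbert (uniform_flats n n) {} = (\<Sum>\<sigma>\<in>{\<sigma>. \<sigma> permutes {1..n}}. fps_X ^ exc n \<sigma>)"
proof -
  interpret uniform_rank n n by unfold_locales (use assms in auto)
  have "chow_hilbert (uniform_flats n n) {} = (\<Sum>T\<in>Pow {1..n}. top_poly T)"
    using boolean_fy_generating_function[of "{1..n}"] assms by (simp add: chow_hilbert_eq_fy)
  also have "\<dots> = (\<Sum>T\<in>Pow {1..n}. derange_poly T)"
    using finite_subset[of _ "{1..n}"] by (intro sum.cong) (auto intro: top_poly_eq_derange_poly)
  also have "\<dots> = (\<Sum>\<sigma>\<in>{\<sigma>. \<sigma> permutes {1..n}}. fps_X ^ exceed \<sigma>)"
    unfolding derange_poly_def by (rule permutations_by_support[symmetric]) simp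
  also have "\<dots> = (\<Sum>\<sigma>\<in>{\<sigma>. \<sigma> permutes {1..n}}. fps_X ^ exc n \<sigma>)"
    by (rule sum.cong) (auto simp: exc_eq_exceed)
  finally show ?thesis .
qed

text \<open>Passing from rank \<open>j\<close> to \<open>j + 1\<close> extends each geometric sum by
  the single term \<open>fps_X ^ (j - card T)\<close>, if \<open>card T \<le> j\<close>.\<close>

lemma chow_hilbert_uniform_step:
  assumes "1 \<le> j" "Suc j \<le> n"
  shows "chow_hilbert (uniform_flats n (Suc j)) {} - chow_hilbert (uniform_flats n j) {}
    = (\<Sum>\<sigma>\<in>F_set n (n - j). fps_X ^ (j - exc n \<sigma>))"
proof -
  have "(\<Sum>e<Suc j - k. fps_X ^ e) - (\<Sum>e<j - k. fps_X ^ e) = (if k \<le> j then fps_X ^ (j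
      - k) else (0 :: int fps))" for k
    by (simp add: Suc_diff_le)
  then show ?thesis
    using assms by (simp only: chow_hilbert_uniform Suc_leD le_SucI sum_F_set sum_subtractf[symmetric] right_diff_distrib[symmetric])
      (intro sum.cong; simp add: mult.commute)
qed

text \<open>Multiplication by \<open>fps_X\<close> makes the geometric sums start at exponent 1,
  which is the recursion for \<open>top_poly {1..n}\<close>; the factor is cancelled at the
  end.\<close>

lemma chow_hilbert_derangements:
  assumes n: "2 \<le> n"
  shows "chow_hilbert (uniform_flats n (n - 1)) {} = (\<Sum>\<sigma>\<in>derangements n. fps_X ^ (exc n \<sigma> - 1))"
proof -
  have fin: "finite {1..n}" "{1..n} \<noteq> {}" using n by auto
  have shift: "fps_X * (\<Sum>e<k - 1. fps_X ^ e) = (\<Sum>e\<in>{1..<k}. fps_X ^ e :: int fps)" if "0 < k" for k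
  proof -
    have "{1..<k} = Suc ` {..<k - 1}" using that by (auto simp: image_Suc_lessThan)
    then show ?thesis by (simp add: sum.reindex sum_distrib_left)
  qed
  have "fps_X * chow_hilbert (uniform_flats n (n - 1)) {}
    = (\<Sum>T\<in>Pow {1..n}. top_poly T * (fps_X * (\<Sum>e<n - 1 - card T. fps_X ^ e)))"
    using n by (subst chow_hilbert_uniform) (simp_all add: sum_distrib_left mult.left_commute)
  also have "\<dots> = (\<Sum>T\<in>{T. T \<subseteq> {1..n} \<and> card T < n}. top_poly T * (fps_X * (\<Sum>e<n
      - 1 - card T. fps_X ^ e)))"
  proof (rule sum.mono_neutral_right)
    show "\<forall>T\<in>Pow {1..n} - {T. T \<subseteq> {1..n} \<and> card T < n}. top_poly T * (fps_X * (\<Sum>e<n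
        - 1 - card T. fps_X ^ e)) = 0"
    proof
      fix T assume "T \<in> Pow {1..n} - {T. T \<subseteq> {1..n} \<and> card T < n}"
      then have "n - 1 - card T = 0" by auto
      then show "top_poly T * (fps_X * (\<Sum>e<n - 1 - card T. fps_X ^ e)) = 0" by simp
    qed
  qed auto
  also have "\<dots> = (\<Sum>T\<in>{T. T \<subseteq> {1..n} \<and> card T < n}. top_poly T * (\<Sum>e\<in>{1..<n
      - card T}. fps_X ^ e))"
  proof (rule sum.cong[OF refl])
    fix T assume "T \<in> {T. T \<subseteq> {1..n} \<and> card T < n}"
    then have "fps_X * (\<Sum>e<n - card T - 1. fps_X ^ e) = (\<Sum>e\<in>{1..<n - card T}. fps_X ^ e :: int fps)"
      by (intro shift) simp
    then show "top_poly T * (fps_X * (\<Sum>e<n - 1 - card T. fps_X ^ e)) = top_poly T * (\<Sum>e\<in>{1..<n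
        - card T}. fps_X ^ e)"
      by (simp add: diff_right_commute)
  qed
  also have "\<dots> = top_poly {1..n}" using top_poly_recursion[OF fin] by simp
  also have "\<dots> = (\<Sum>\<sigma>\<in>derange {1..n}. fps_X ^ exceed \<sigma>)"
    using top_poly_eq_derange_poly[OF fin(1)] by (simp add: derange_poly_def)
  also have "\<dots> = (\<Sum>\<sigma>\<in>derange {1..n}. fps_X * fps_X ^ (exc n \<sigma> - 1))"
  proof (rule sum.cong[OF refl])
    fix \<sigma> assume "\<sigma> \<in> derange {1..n}"
    then have \<sigma>: "\<sigma> permutes {1..n}" "\<forall>i\<in>{1..n}. \<sigma> i \<noteq> i" by (auto simp: derange_def)
    \<comment> \<open>A derangement has an excedance at 1, so subtracting 1 from
      \<open>exc n \<sigma>\<close> is exact.\<close>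
    have "\<sigma> 1 \<in> {1..n}" using n permutes_in_image[OF \<sigma>(1), of 1] by simp
    moreover have "\<sigma> 1 \<noteq> 1" using \<sigma>(2) n by simp
    ultimately have "1 \<in> {i\<in>{1..n}. \<sigma> i > i}" using n by auto
    moreover have "finite {i\<in>{1..n}. \<sigma> i > i}" by simp
    ultimately have "0 < exc n \<sigma>" unfolding exc_def card_gt_0_iff by blast
    then show "fps_X ^ exceed \<sigma> = fps_X * (fps_X ^ (exc n \<sigma> - 1) :: int fps)"
      using exc_eq_exceed[OF \<sigma>(1)] by (simp flip: power_Suc)
  qed
  also have "\<dots> = fps_X * (\<Sum>\<sigma>\<in>derangements n. fps_X ^ (exc n \<sigma> - 1))"
    by (simp add: derangements_def derange_def sum_distrib_left)
  finally show ?thesis by simp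
qed

theorem theorem5p1:
  fixes n r :: nat
  assumes "1 \<le> r" and "r \<le> n"
  shows "chow_hilbert (uniform_flats n r) {} =
           (\<Sum>\<sigma>\<in>{\<sigma>. \<sigma> permutes {1..n}}. fps_X ^ exc n \<sigma>)
         - (\<Sum>j\<in>{r..n-1}. \<Sum>\<sigma>\<in>F_set n (n - j). fps_X ^ (j - exc n \<sigma>))
    \<and> chow_hilbert (uniform_flats n n) {} = (\<Sum>\<sigma>\<in>{\<sigma>. \<sigma> permutes {1..n}}. fps_X ^ exc n \<sigma>)
    \<and> (2 \<le> n \<longrightarrow> chow_hilbert (uniform_flats n (n - 1)) {} =
           (\<Sum>\<sigma>\<in>derangements n. fps_X ^ (exc n \<sigma> - 1)))"
proof (intro conjI impI)
  let ?H = "\<lambda>j. chow_hilbert (uniform_flats n j) {}"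
  show boolean: "?H n = (\<Sum>\<sigma>\<in>{\<sigma>. \<sigma> permutes {1..n}}. fps_X ^ exc n \<sigma>)"
    using assms by (intro chow_hilbert_boolean) simp
  \<comment> \<open>The correction terms are differences of consecutive ranks and telescope.\<close>
  have "(\<Sum>j\<in>{r..n-1}. \<Sum>\<sigma>\<in>F_set n (n - j). fps_X ^ (j - exc n \<sigma>))
      = (\<Sum>j\<in>{r..<n}. ?H (Suc j) - ?H j)"
    using assms by (intro sum.cong) (auto intro!: chow_hilbert_uniform_step[symmetric])
  also have "\<dots> = ?H n - ?H r" using assms(2) by (rule sum_Suc_diff')
  finally show "?H r = (\<Sum>\<sigma>\<in>{\<sigma>. \<sigma> permutes {1..n}}. fps_X ^ exc n \<sigma>)
      - (\<Sum>j\<in>{r..n-1}. \<Sum>\<sigma>\<in>F_set n (n - j). fps_X ^ (j - exc n \<sigma>))"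
    by (simp add: boolean)
qed (rule chow_hilbert_derangements)

end
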